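(* Assume that matrices $R_\chi\in\mathbb{R}^{n\times n}$, $G_{\gamma,\delta}\in\mathbb{R}^{n\times n}$ and $F_{\gamma,\delta}\in\mathbb{R}^{m\times n}$ (for $\chi=(\alpha,\beta,\gamma,\delta)\in\mathfrak X$) satisfy, for every $\chi=(\alpha,\beta,\gamma,\delta)\in\mathfrak X$, the linear matrix inequality $$\begin{bmatrix} R_\chi & A_\alpha G_{\gamma,\delta}+B_\alpha F_{\gamma,\delta}\\ \star & G_{\gamma,\delta}+G_{\gamma,\delta}^\top-\bar{\mathcal D}_\chi(R)\end{bmatrix}>0 .$$ For each $\gamma\in[N]$ and $\delta\in[T]$ define $K_{\gamma,\delta}=F_{\gamma,\delta}G_{\gamma,\delta}^{-1}$. Then the resulting closed-loop system $\Sigma_K$ is mean square stable.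
   Context: Notation. $[N]=\{1,\dots,N\}$; $\mathbb N$ is the set of nonnegative integers; for an integer $k$ and positive integer $T$, $\lfloor k\rfloor_T$ is the unique element of $\{0,\dots,T-1\}$ congruent to $k$ modulo $T$; indicator functions are written $\mathbf 1(\cdot)$, with this symbol being $1$ if the condition holds and $0$ otherwise; $\|\cdot\|$ is the Euclidean norm; $A>0$ means that $A$ is real symmetric positive definite; $\star$ denotes a block determined by symmetry. Open-loop system. $n,m,q,\ell,N,M,T$ are positive integers. For $i\in[N]$, $A_i\in\mathbb{R}^{n\times n}$, $B_i\in\mathbb{R}^{n\times m}$, $C_i\in\mathbb{R}^{\ell\times n}$, $D_i\in\mathbb{R}^{\ell\times m}$, $E_i\in\mathbb{R}^{n\times q}$. The mode $r=\{r(k)\}_{k\ge0}$ is a time-homogeneous Markov chain on $[N]$ with transition matrix $P=(p_{\alpha\alpha'})$, and $s=\{s(k)\}_{k\ge0}$ is a time-homogeneous Markov chain on $[M]$ with transition matrix $(q_{\beta\beta'})$, independent of $r$. The system is $x(k+1)=A_{r(k)}x(k)+B_{r(k)}u(k)+E_{r(k)}w(k)$, $z(k)=C_{r(k)}x(k)+D_{r(k)}u(k)$, with $x(0)=x_0$, $r(0)=r_0$, $s(0)=s_0$. Observation process. A function $f:[M]\to\{0,1\}$ is given. Observation times: $t_0=\min\{k\ge0: f(s(k))=1\}$, $t_{i+1}=\min\{k>t_i: f(s(k))=1\}$ ($\min\emptyset=\infty$). For $k\ge t_0$, $\tau(k)=\max\{t_i: t_i\le k\}$ and $\sigma(k)=r(\tau(k))$;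 for $k<t_0$, $\tau(k)=\tau_0$ and $\sigma(k)=\sigma_0$, where $\tau_0$ is an integer with $\tau_0=0$ if $t_0=0$ and $\tau_0<0$ otherwise, and $\sigma_0\in[N]$ with $\sigma_0=r_0$ if $t_0=0$. Put $\rho(k)=\lfloor k-\tau(k)\rfloor_T+1\in[T]$, $\rho_0=\rho(0)$. Closed loop. Given gains $K_{\gamma,\delta}\in\mathbb{R}^{m\times n}$ ($\gamma\in[N],\delta\in[T]$), the feedback $u(k)=K_{\sigma(k),\rho(k)}x(k)$ gives the closed-loop system $\Sigma_K$: $x(k+1)=(A_{r(k)}+B_{r(k)}K_{\sigma(k),\rho(k)})x(k)+E_{r(k)}w(k)$, $z(k)=(C_{r(k)}+D_{r(k)}K_{\sigma(k),\rho(k)})x(k)$. Let $\bar r(k)=(r(k),s(k),\sigma(k),\rho(k))$, $\bar r_0=\bar r(0)$, and let $\mathfrak X$ be the set of $(\alpha,\beta,\gamma,\delta)\in[N]\times[M]\times[N]\times[T]$ such that $f(\beta)=1$ implies $\alpha=\gamma$ and $\delta=1$; $\bar r$ takes values in $\mathfrak X$. For pairs $(\gamma,\delta)$ that do not occur as the last two components of any element of $\mathfrak X$, the gain $K_{\gamma,\delta}$ never enters the closed loop and may be taken arbitrary. For $\chi=(\alpha,\beta,\gamma,\delta)$, $\chi'=(\alpha',\beta',\gamma',\delta')$ in $\mathfrak X$ put $\bar p_{\chi\chi'}=\mathbf 1(\alpha'=\gamma',\ \delta'=1)\,p_{\alpha\alpha'}q_{\beta\beta'}$ if $f(\beta')=1$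 and $\bar p_{\chi\chi'}=\mathbf 1(\gamma'=\gamma,\ \lfloor\delta'-\delta-1\rfloor_T=0)\,p_{\alpha\alpha'}q_{\beta\beta'}$ otherwise (these are the transition probabilities of $\bar r$). For a family $R=\{R_\chi\}_{\chi\in\mathfrak X}\subset\mathbb{R}^{n\times n}$, $\bar{\mathcal D}_\chi(R)=\sum_{\chi'\in\mathfrak X}\bar p_{\chi'\chi}R_{\chi'}$. Mean square stability of $\Sigma_K$: there exist $C>0$ and $\lambda\in[0,1)$ such that, with $w\equiv0$, $E[\|x(k)\|^2]\le C\lambda^k\|x_0\|^2$ for all $x_0\in\mathbb{R}^n$, all $\bar r_0\in\mathfrak X$ and all $k\ge0$. *)

theory Defs
  imports "HOL-Probability.Probability"
begin

text \<open>
  The mode sets \<open>[N]\<close> and \<open>[M]\<close> are rendered as arbitrary finite types \<open>'i\<close> and \<open>'j\<close>; the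
  dimensions \<open>n\<close>, \<open>m\<close>, \<open>l\<close>, \<open>q\<close> are the cardinalities of the finite index types \<open>'n\<close>, \<open>'m\<close>,
  \<open>'l\<close>, \<open>'q\<close>. The set \<open>[T]\<close> is \<open>{1..T}\<close>, and the residue of an integer \<open>k\<close> modulo \<open>T\<close> is
  \<open>k mod int T\<close>, which lies in \<open>{0..<int T}\<close> for \<open>T > 0\<close>.
\<close>

definition block_matrix ::
  "real^'a^'a \<Rightarrow> real^'b^'a \<Rightarrow> real^'a^'b \<Rightarrow> real^'b^'b \<Rightarrow> real^('a + 'b)^('a + 'b)"
  where
  "block_matrix P Q R S = (\<chi> i j.
     case i of
       Inl a \<Rightarrow> (case j of Inl a' \<Rightarrow> P $ a $ a' | Inr b' \<Rightarrow> Q $ a $ b')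
     | Inr b \<Rightarrow> (case j of Inl a' \<Rightarrow> R $ b $ a' | Inr b' \<Rightarrow> S $ b $ b'))"

definition pos_def :: "real^'a^'a \<Rightarrow> bool" where
  "pos_def P \<longleftrightarrow> transpose P = P \<and> (\<forall>x. x \<noteq> 0 \<longrightarrow> x \<bullet> (P *v x) > 0)"

record ('i, 'n, 'm, 'l, 'q) jump_system =
  mat_A :: "'i \<Rightarrow> real^'n^'n"
  mat_B :: "'i \<Rightarrow> real^'m^'n"
  mat_C :: "'i \<Rightarrow> real^'n^'l"
  mat_D :: "'i \<Rightarrow> real^'m^'l"
  mat_E :: "'i \<Rightarrow> real^'q^'n"

definition stochastic :: "('i::finite \<Rightarrow> 'i \<Rightarrow> real) \<Rightarrow> bool" where
  "stochastic p \<longleftrightarrow> (\<forall>a b. p a b \<ge> 0) \<and> (\<forall>a. (\<Sum>b\<in>UNIV. p a b) = 1)"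

definition markov_chain ::
  "'w measure \<Rightarrow> (nat \<Rightarrow> 'w \<Rightarrow> 'i::finite) \<Rightarrow> ('i \<Rightarrow> 'i \<Rightarrow> real) \<Rightarrow> 'i \<Rightarrow> bool"
  where
  "markov_chain \<Omega> X p x0 \<longleftrightarrow>
     (\<forall>k. X k \<in> measurable \<Omega> (count_space UNIV)) \<and>
     (AE \<omega> in \<Omega>. X 0 \<omega> = x0) \<and>
     (\<forall>k h b. \<P>(\<omega> in \<Omega>. \<forall>i\<le>k. X i \<omega> = h i) > 0 \<longrightarrow>
        \<P>(\<omega> in \<Omega>. X (Suc k) \<omega> = b \<bar> \<forall>i\<le>k. X i \<omega> = h i) = p (h k) b)"

text \<open>Independence of the two processes is independence of the \<open>\<sigma>\<close>-algebras they generate; the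
  library's \<open>indep_var\<close> would require both to have the same state type.\<close>

definition realization ::
  "'w measure \<Rightarrow> (nat \<Rightarrow> 'w \<Rightarrow> 'i::finite) \<Rightarrow> (nat \<Rightarrow> 'w \<Rightarrow> 'j::finite) \<Rightarrow>
   ('i \<Rightarrow> 'i \<Rightarrow> real) \<Rightarrow> ('j \<Rightarrow> 'j \<Rightarrow> real) \<Rightarrow> 'i \<Rightarrow> 'j \<Rightarrow> bool"
  where
  "realization \<Omega> r s p q r0 s0 \<longleftrightarrow>
     prob_space \<Omega> \<and> markov_chain \<Omega> r p r0 \<and> markov_chain \<Omega> s q s0 \<and>
     prob_space.indep_set \<Omega>
       (sets (vimage_algebra (space \<Omega>) (\<lambda>\<omega> k. r k \<omega>) (Pi\<^sub>M UNIV (\<lambda>_. count_space UNIV))))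
       (sets (vimage_algebra (space \<Omega>) (\<lambda>\<omega> k. s k \<omega>) (Pi\<^sub>M UNIV (\<lambda>_. count_space UNIV))))"

text \<open>Here \<open>r\<close> and \<open>s\<close> are single sample paths. Note that \<open>Inf {} = \<infinity>\<close> in \<^typ>\<open>enat\<close>,
  and that all later observation times are infinite once one of them is.\<close>

primrec obs_time :: "('j \<Rightarrow> nat) \<Rightarrow> (nat \<Rightarrow> 'j) \<Rightarrow> nat \<Rightarrow> enat" where
  "obs_time f s 0 = Inf (enat ` {k. f (s k) = 1})"
| "obs_time f s (Suc i) = Inf (enat ` {k. obs_time f s i < enat k \<and> f (s k) = 1})"

definition obs_tau :: "('j \<Rightarrow> nat) \<Rightarrow> int \<Rightarrow> (nat \<Rightarrow> 'j) \<Rightarrow> nat \<Rightarrow> int" where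
  "obs_tau f \<tau>0 s k =
     (if enat k < obs_time f s 0 then \<tau>0
      else int (Max {j. j \<le> k \<and> enat j \<in> range (obs_time f s)}))"

definition obs_sigma ::
  "('j \<Rightarrow> nat) \<Rightarrow> int \<Rightarrow> 'i \<Rightarrow> (nat \<Rightarrow> 'i) \<Rightarrow> (nat \<Rightarrow> 'j) \<Rightarrow> nat \<Rightarrow> 'i"
  where
  "obs_sigma f \<tau>0 \<sigma>0 r s k =
     (if enat k < obs_time f s 0 then \<sigma>0 else r (nat (obs_tau f \<tau>0 s k)))"

definition obs_rho :: "('j \<Rightarrow> nat) \<Rightarrow> nat \<Rightarrow> int \<Rightarrow> (nat \<Rightarrow> 'j) \<Rightarrow> nat \<Rightarrow> nat" where
  "obs_rho f T \<tau>0 s k = nat ((int k - obs_tau f \<tau>0 s k) mod int T) + 1"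

text \<open>The initial observation data: \<open>t\<^sub>0 = 0\<close> means \<open>f s\<^sub>0 = 1\<close>, and \<open>\<rho>\<^sub>0 = \<rho>(0)\<close> is determined
  by \<open>\<tau>\<^sub>0\<close>, as \<open>\<tau>(0) = \<tau>\<^sub>0\<close> in either case.\<close>

definition initial_data ::
  "('j \<Rightarrow> nat) \<Rightarrow> nat \<Rightarrow> 'i \<Rightarrow> 'j \<Rightarrow> 'i \<Rightarrow> nat \<Rightarrow> int \<Rightarrow> bool"
  where
  "initial_data f T r0 s0 \<sigma>0 \<rho>0 \<tau>0 \<longleftrightarrow>
     (if f s0 = 1 then \<tau>0 = 0 \<and> \<sigma>0 = r0 else \<tau>0 < 0) \<and>
     \<rho>0 = nat ((- \<tau>0) mod int T) + 1"

definition ext_modes :: "('j \<Rightarrow> nat) \<Rightarrow> nat \<Rightarrow> ('i \<times> 'j \<times> 'i \<times> nat) set" where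
  "ext_modes f T =
     {(\<alpha>, \<beta>, \<gamma>, \<delta>). \<delta> \<in> {1..T} \<and> (f \<beta> = 1 \<longrightarrow> \<alpha> = \<gamma> \<and> \<delta> = 1)}"

fun ext_trans ::
  "('i \<Rightarrow> 'i \<Rightarrow> real) \<Rightarrow> ('j \<Rightarrow> 'j \<Rightarrow> real) \<Rightarrow> ('j \<Rightarrow> nat) \<Rightarrow> nat \<Rightarrow>
   'i \<times> 'j \<times> 'i \<times> nat \<Rightarrow> 'i \<times> 'j \<times> 'i \<times> nat \<Rightarrow> real"
  where
  "ext_trans p q f T (\<alpha>, \<beta>, \<gamma>, \<delta>) (\<alpha>', \<beta>', \<gamma>', \<delta>') =
     (if f \<beta>' = 1
      then of_bool (\<alpha>' = \<gamma>' \<and> \<delta>' = 1) * p \<alpha> \<alpha>' * q \<beta> \<beta>'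
      else of_bool (\<gamma>' = \<gamma> \<and> (int \<delta>' - int \<delta> - 1) mod int T = 0) * p \<alpha> \<alpha>' * q \<beta> \<beta>')"

definition ext_D ::
  "('i \<Rightarrow> 'i \<Rightarrow> real) \<Rightarrow> ('j \<Rightarrow> 'j \<Rightarrow> real) \<Rightarrow> ('j \<Rightarrow> nat) \<Rightarrow> nat \<Rightarrow>
   ('i \<times> 'j \<times> 'i \<times> nat \<Rightarrow> real^'n^'n) \<Rightarrow> 'i \<times> 'j \<times> 'i \<times> nat \<Rightarrow> real^'n^'n"
  where
  "ext_D p q f T R c = (\<Sum>c'\<in>ext_modes f T. ext_trans p q f T c' c *\<^sub>R R c')"

text \<open>Sample paths of state and output of the closed loop, for sample paths \<open>r\<close>, \<open>\<sigma>\<close>, \<open>\<rho>\<close> and a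
  disturbance \<open>w\<close>.\<close>

primrec closed_loop_state ::
  "('i, 'n::finite, 'm::finite, 'l::finite, 'q::finite) jump_system \<Rightarrow>
   ('i \<Rightarrow> nat \<Rightarrow> real^'n^'m) \<Rightarrow> (nat \<Rightarrow> 'i) \<Rightarrow> (nat \<Rightarrow> 'i) \<Rightarrow> (nat \<Rightarrow> nat) \<Rightarrow>
   (nat \<Rightarrow> real^'q) \<Rightarrow> real^'n \<Rightarrow> nat \<Rightarrow> real^'n"
  where
  "closed_loop_state Sys K r \<sigma> \<rho> w x0 0 = x0"
| "closed_loop_state Sys K r \<sigma> \<rho> w x0 (Suc k) =
     (mat_A Sys (r k) + mat_B Sys (r k) ** K (\<sigma> k) (\<rho> k))
       *v closed_loop_state Sys K r \<sigma> \<rho> w x0 k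
     + mat_E Sys (r k) *v w k"

definition closed_loop_output ::
  "('i, 'n::finite, 'm::finite, 'l::finite, 'q::finite) jump_system \<Rightarrow>
   ('i \<Rightarrow> nat \<Rightarrow> real^'n^'m) \<Rightarrow> (nat \<Rightarrow> 'i) \<Rightarrow> (nat \<Rightarrow> 'i) \<Rightarrow> (nat \<Rightarrow> nat) \<Rightarrow>
   (nat \<Rightarrow> real^'q) \<Rightarrow> real^'n \<Rightarrow> nat \<Rightarrow> real^'l"
  where
  "closed_loop_output Sys K r \<sigma> \<rho> w x0 k =
     (mat_C Sys (r k) + mat_D Sys (r k) ** K (\<sigma> k) (\<rho> k))
       *v closed_loop_state Sys K r \<sigma> \<rho> w x0 k"

text \<open>The constants \<open>C\<close> and \<open>\<mu>\<close> are uniform over all initial data and over all probability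
  spaces on the sample type \<open>'w\<close> carrying the chains. A given \<open>'w\<close> may be too small to carry
  them; statements about stability are meant for arbitrary \<open>'w\<close>.
  The expectation of the nonnegative variable is its integral in the extended nonnegative
  reals, so the bound includes its finiteness.\<close>

definition mean_square_stable ::
  "'w itself \<Rightarrow>
   ('i::finite, 'n::finite, 'm::finite, 'l::finite, 'q::finite) jump_system \<Rightarrow>
   ('i \<Rightarrow> 'i \<Rightarrow> real) \<Rightarrow> ('j::finite \<Rightarrow> 'j \<Rightarrow> real) \<Rightarrow> ('j \<Rightarrow> nat) \<Rightarrow> nat \<Rightarrow>
   ('i \<Rightarrow> nat \<Rightarrow> real^'n^'m) \<Rightarrow> bool"
  where
  "mean_square_stable (_ :: 'w itself) Sys p q f T K \<longleftrightarrow>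
     (\<exists>C>0. \<exists>\<mu>. 0 \<le> \<mu> \<and> \<mu> < 1 \<and>
       (\<forall>(\<Omega> :: 'w measure) r s x0 r0 s0 \<sigma>0 \<rho>0 \<tau>0 k.
          (r0, s0, \<sigma>0, \<rho>0) \<in> ext_modes f T \<longrightarrow>
          initial_data f T r0 s0 \<sigma>0 \<rho>0 \<tau>0 \<longrightarrow>
          realization \<Omega> r s p q r0 s0 \<longrightarrow>
          (\<integral>\<^sup>+ \<omega>. ennreal ((norm (closed_loop_state Sys K (\<lambda>i. r i \<omega>)
               (obs_sigma f \<tau>0 \<sigma>0 (\<lambda>i. r i \<omega>) (\<lambda>i. s i \<omega>))
               (obs_rho f T \<tau>0 (\<lambda>i. s i \<omega>)) (\<lambda>_. 0) x0 k))\<^sup>2) \<partial>\<Omega>)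
            \<le> ennreal (C * \<mu> ^ k * (norm x0)\<^sup>2)))"

end

theory Submission
  imports Defs
begin

text \<open>
  Write \<open>A\<^sub>c\<close> for the closed-loop matrix and \<open>D\<^sub>c(R)\<close> for \<open>ext_D p q f T R c\<close> in the extended
  mode \<open>c\<close>. Eliminating the slack variable \<open>G\<close> from the matrix inequality leaves
  \<open>R\<^sub>c > A\<^sub>c D\<^sub>c(R) A\<^sub>c\<^sup>T\<close>, and compactness of the unit sphere improves this to
  \<open>A\<^sub>c D\<^sub>c(R) A\<^sub>c\<^sup>T \<le> \<mu> R\<^sub>c\<close> with a common \<open>\<mu> < 1\<close>. The second moment of \<open>x(k+1)\<close> on the event
  that the extended mode at time \<open>k\<close> is \<open>c\<close> evolves by \<open>S \<mapsto> A\<^sub>c D\<^sub>c(S) A\<^sub>c\<^sup>T\<close>, an order-preserving map,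
  so it stays below a multiple of \<open>\<mu>^k R\<^sub>c\<close>. Pairing \<open>x(k+1)\<close>, rather than \<open>x(k)\<close>, with the mode at
  time \<open>k\<close> is what lets the forward recursion match the inequality for \<open>R\<close> directly.
\<close>

subsection \<open>Elimination of the slack variable\<close>

text \<open>Symmetry is compared block by block, and the quadratic form is evaluated at the vector
  \<open>z\<close> stacked from \<open>x\<close> and \<open>y\<close>.\<close>

lemma pos_def_block_matrixD:
  fixes P :: "real^'a::finite^'a" and Q :: "real^'b::finite^'a" and S :: "real^'b^'b"
  assumes "pos_def (block_matrix P Q Q' S)"
  shows "transpose P = P" "transpose S = S" "transpose Q = Q'"
    and "\<lbrakk>x \<noteq> 0 \<or> y \<noteq> 0\<rbrakk> \<Longrightarrow> x \<bullet> (P *v x) + x \<bullet> (Q *v y) + y \<bullet> (Q' *v x) + y \<bullet> (S *v y) > 0"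
proof -
  let ?Z = "block_matrix P Q Q' S"
  have "transpose ?Z = ?Z" using assms by (simp add: pos_def_def)
  then have "transpose ?Z $ i $ j = ?Z $ i $ j" for i j by simp
  then have sym: "?Z $ j $ i = ?Z $ i $ j" for i j by (simp add: transpose_def)
  have "P $ b $ a = P $ a $ b" for a b
    using sym[of "Inl b" "Inl a"] by (simp add: block_matrix_def)
  then show "transpose P = P" by (simp add: transpose_def vec_eq_iff)
  have "S $ b $ a = S $ a $ b" for a b
    using sym[of "Inr b" "Inr a"] by (simp add: block_matrix_def)
  then show "transpose S = S" by (simp add: transpose_def vec_eq_iff)
  have "Q $ b $ a = Q' $ a $ b" for a b
    using sym[of "Inl b" "Inr a"] by (simp add: block_matrix_def)
  then show "transpose Q = Q'" by (simp add: transpose_def vec_eq_iff)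
  assume nz: "x \<noteq> 0 \<or> y \<noteq> 0"
  define z :: "real^('a + 'b)" where "z = (\<chi> i. case i of Inl a \<Rightarrow> x $ a | Inr b \<Rightarrow> y $ b)"
  have split: "(\<Sum>i\<in>UNIV. g i) = (\<Sum>a\<in>UNIV. g (Inl a)) + (\<Sum>b\<in>UNIV. g (Inr b))"
    for g :: "'a + 'b \<Rightarrow> real"
    unfolding UNIV_Plus_UNIV[symmetric] by (subst sum.Plus) auto
  have "z \<noteq> 0"
  proof
    assume "z = 0"
    then have "z $ Inl a = 0" "z $ Inr b = 0" for a b by simp_all
    then show False using nz by (auto simp: z_def vec_eq_iff)
  qed
  then have "z \<bullet> (?Z *v z) > 0" using assms by (simp add: pos_def_def)
  also have "z \<bullet> (?Z *v z) = x \<bullet> (P *v x) + x \<bullet> (Q *v y) + y \<bullet> (Q' *v x) + y \<bullet> (S *v y)"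
    by (simp add: inner_vec_def matrix_vector_mult_def split z_def block_matrix_def
        sum.distrib distrib_left)
  finally show "x \<bullet> (P *v x) + x \<bullet> (Q *v y) + y \<bullet> (Q' *v x) + y \<bullet> (S *v y) > 0" .
qed

lemma matrix_add_rdistrib:
  fixes A B :: "'a::semiring_1^'n::finite^'m::finite"
  shows "(A + B) ** C = A ** C + B ** C"
  by (simp add: vec_eq_iff matrix_matrix_mult_def distrib_right sum.distrib)

lemma matrix_inv_cancel:
  fixes A :: "'a::semiring_1^'n::finite^'m::finite"
  assumes "invertible A"
  shows "A ** matrix_inv A = mat 1" "matrix_inv A ** A = mat 1"
proof -
  have "A ** matrix_inv A = mat 1 \<and> matrix_inv A ** A = mat 1"
    using assms unfolding invertible_def matrix_inv_def by (rule someI_ex)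
  then show "A ** matrix_inv A = mat 1" "matrix_inv A ** A = mat 1" by simp_all
qed

text \<open>On the kernel of \<open>G\<close> the lower right block has quadratic form
  \<open>- (y \<bullet> (D *v y)) \<le> 0\<close>, which contradicts its positivity unless
  \<open>y = 0\<close>. A square matrix with trivial kernel is invertible.\<close>

lemma slack_lmi_invertible:
  fixes G D :: "real^'n::finite^'n" and N :: "real^'n^'k::finite"
  assumes lmi: "pos_def (block_matrix P N N' (G + transpose G - D))"
    and psd: "\<And>y. y \<bullet> (D *v y) \<ge> 0"
  shows "invertible G"
proof -
  have "y = 0" if "G *v y = 0" for y
  proof (rule ccontr)
    assume "y \<noteq> 0"
    then have "y \<bullet> ((G + transpose G - D) *v y) > 0"
      using pos_def_block_matrixD(4)[OF lmi, of 0 y] by simp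
    moreover have "y \<bullet> (y v* G) = 0"
      by (subst inner_commute) (simp add: dot_lmul_matrix that)
    ultimately show False
      using psd[of y] that by (simp add: algebra_simps inner_diff_right inner_add_right)
  qed
  then show ?thesis
    by (simp add: invertible_left_inverse matrix_left_invertible_ker)
qed

text \<open>The slack variable \<open>G\<close> is eliminated by testing the block inequality on \<open>(x, y)\<close> with
  \<open>G y = - D A\<^sup>T x\<close>; this needs no invertibility of \<open>D\<close>, unlike a Schur complement.\<close>

lemma slack_lmi_lyapunov:
  fixes A :: "real^'n::finite^'k::finite" and G D :: "real^'n^'n"
  assumes lmi: "pos_def (block_matrix P (A ** G) N' (G + transpose G - D))"
    and sym: "transpose D = D" and psd: "\<And>y. y \<bullet> (D *v y) \<ge> 0" and "x \<noteq> 0"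
  shows "(x v* A) \<bullet> (D *v (x v* A)) < x \<bullet> (P *v x)"
proof -
  define v where "v = x v* A"
  define y where "y = - (matrix_inv G *v (D *v v))"
  have "invertible G" using lmi psd by (rule slack_lmi_invertible)
  moreover have mv_minus: "G *v (- w) = - (G *v w)" for w
    using matrix_vector_mult_diff_distrib[of G 0 w] by simp
  ultimately have Gy: "G *v y = - (D *v v)"
    by (simp add: y_def matrix_vector_mul_assoc mv_minus matrix_mul_assoc matrix_inv_cancel)
  have D: "a \<bullet> (D *v b) = b \<bullet> (D *v a)" for a b
    using dot_lmul_matrix[of a D b] transpose_matrix_vector[of D a] sym by (simp add: inner_commute)
  have xN: "x \<bullet> ((A ** G) *v y) = - (v \<bullet> (D *v v))"
    using dot_lmul_matrix[of x A "G *v y"]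
    by (simp add: Gy matrix_vector_mul_assoc[symmetric] flip: v_def)
  have "N' = transpose (A ** G)" using pos_def_block_matrixD(3)[OF lmi] by simp
  then have yN: "y \<bullet> (N' *v x) = x \<bullet> ((A ** G) *v y)"
    by (simp add: dot_lmul_matrix inner_commute[of y])
  have yG: "y \<bullet> (G *v y) = - (y \<bullet> (D *v v))" "y \<bullet> (y v* G) = - (y \<bullet> (D *v v))"
    using Gy by (simp_all add: dot_lmul_matrix inner_commute[of y "y v* G"])
  have "0 < x \<bullet> (P *v x) + x \<bullet> ((A ** G) *v y) + y \<bullet> (N' *v x)
            + y \<bullet> ((G + transpose G - D) *v y)"
    using pos_def_block_matrixD(4)[OF lmi, of x y] \<open>x \<noteq> 0\<close> by simp
  \<comment> \<open>Completing the square: the two off-diagonal terms contribute \<open>-2\<close>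
    times \<open>v \<bullet> (D *v v)\<close>, the terms with \<open>G\<close> and its transpose
    contribute \<open>-2\<close> times \<open>y \<bullet> (D *v v)\<close>. The remaining square has
    a favourable sign because \<open>D\<close> is positive semidefinite.\<close>
  also have "\<dots> = x \<bullet> (P *v x) - v \<bullet> (D *v v) - (y + v) \<bullet> (D *v (y + v))"
    using D[of v y] xN yN yG
    by (simp add: algebra_simps inner_diff_right inner_add_right inner_diff_left inner_add_left)
  finally show ?thesis using psd[of "y + v"] by (simp add: v_def)
qed

section \<open>Uniform constants from compactness of the unit sphere\<close>

lemma quadratic_form_bound:
  fixes Q :: "real^'n::finite \<Rightarrow> real" and P :: "real^'n^'n"
  assumes P: "\<And>x. x \<noteq> 0 \<Longrightarrow> x \<bullet> (P *v x) > 0"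
    and Q: "continuous_on UNIV Q" "\<And>a x. Q (a *\<^sub>R x) = a\<^sup>2 * Q x"
  shows "\<forall>\<^sub>F c in at_top. \<forall>x. Q x \<le> c * (x \<bullet> (P *v x))"
proof -
  \<comment> \<open>Numerator and denominator are homogeneous of degree two, so it suffices to bound
    this ratio on the unit sphere, where it is continuous.\<close>
  let ?g = "\<lambda>x. Q x / (x \<bullet> (P *v x))"
  have "x \<bullet> (P *v x) \<noteq> 0" if "x \<in> sphere 0 1" for x
    using P[of x] that by fastforce
  moreover have "continuous_on (sphere 0 1) (\<lambda>x. x \<bullet> (P *v x))"
    by (intro continuous_intros linear_continuous_on matrix_vector_mul_bounded_linear)
  ultimately have "continuous_on (sphere 0 1) ?g"
    by (intro continuous_on_divide continuous_on_subset[OF Q(1)]) auto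
  then have "bounded (?g ` sphere 0 1)"
    by (intro compact_imp_bounded compact_continuous_image) auto
  then obtain B where B': "\<forall>y \<in> ?g ` sphere 0 1. norm y \<le> B"
    unfolding bounded_iff by blast
  have B: "\<bar>?g x\<bar> \<le> B" if "norm x = 1" for x
    unfolding real_norm_def[symmetric] by (rule B'[rule_format, OF imageI]) (simp add: that)
  have "Q x \<le> c * (x \<bullet> (P *v x))" if "c \<ge> B" for c x
  proof (cases "x = 0")
    case True
    then show ?thesis using Q(2)[of 0 0] by simp
  next
    case False
    define u where "u = x /\<^sub>R norm x"
    have u: "norm u = 1" "norm x *\<^sub>R u = x" using False by (simp_all add: u_def)
    have "u \<noteq> 0" using u(1) by auto
    then have "u \<bullet> (P *v u) > 0" by (rule P)
    moreover have "?g u \<le> c" using B[OF u(1)] that by linarith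
    ultimately have "Q u \<le> c * (u \<bullet> (P *v u))" by (simp add: pos_divide_le_eq)
    then have "(norm x)\<^sup>2 * Q u \<le> (norm x)\<^sup>2 * (c * (u \<bullet> (P *v u)))"
      by (intro mult_left_mono) auto
    then have "Q (norm x *\<^sub>R u) \<le> c * ((norm x *\<^sub>R u) \<bullet> (P *v (norm x *\<^sub>R u)))"
      by (simp add: Q(2) matrix_vector_mult_scaleR power2_eq_square mult_ac)
    then show ?thesis unfolding u(2) .
  qed
  then show ?thesis unfolding eventually_at_top_linorder by blast
qed

text \<open>The strict inequality makes the gap \<open>R c - A c ** D c ** transpose (A c)\<close>
  positive definite, so it dominates a fixed fraction of \<open>R c\<close>; this fraction is the
  contraction. The second bound, from Cauchy-Schwarz, starts the later induction over time.\<close>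

lemma lyapunov_constants:
  fixes A D R :: "'c \<Rightarrow> real^'n::finite^'n"
  assumes "finite X"
    and pos: "\<And>c v. \<lbrakk>c \<in> X; v \<noteq> 0\<rbrakk> \<Longrightarrow> v \<bullet> (R c *v v) > 0"
    and lyap: "\<And>c v. \<lbrakk>c \<in> X; v \<noteq> 0\<rbrakk> \<Longrightarrow> (v v* A c) \<bullet> (D c *v (v v* A c)) < v \<bullet> (R c *v v)"
  obtains \<mu> b :: real where "0 < \<mu>" "\<mu> < 1" "0 < b"
    "\<And>c v. c \<in> X \<Longrightarrow> (v v* A c) \<bullet> (D c *v (v v* A c)) \<le> \<mu> * (v \<bullet> (R c *v v))"
    "\<And>c v x. c \<in> X \<Longrightarrow> (v \<bullet> (A c *v x))\<^sup>2 \<le> b * (norm x)\<^sup>2 * (v \<bullet> (R c *v v))"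
proof -
  have vA: "v v* A c = transpose (A c) *v v" for v c by simp
  \<comment> \<open>Each bound holds for all large \<open>b\<close>, so one \<open>b > 1\<close>
    serves every mode and both estimates.\<close>
  have "\<forall>\<^sub>F b in at_top. \<forall>c\<in>X. \<forall>v. v \<bullet> (R c *v v)
      \<le> b * (v \<bullet> ((R c - A c ** D c ** transpose (A c)) *v v))"
  proof (intro eventually_ball_finite[OF \<open>finite X\<close>] ballI quadratic_form_bound)
    fix c and v :: "real^'n" assume "c \<in> X" "v \<noteq> 0"
    then show "v \<bullet> ((R c - A c ** D c ** transpose (A c)) *v v) > 0"
      using lyap[of c v]
      by (simp add: matrix_vector_mult_diff_rdistrib inner_diff_right dot_lmul_matrix
          matrix_vector_mul_assoc[symmetric])
  next
    fix c show "continuous_on UNIV (\<lambda>v. v \<bullet> (R c *v v))"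
      by (intro continuous_intros linear_continuous_on matrix_vector_mul_bounded_linear)
  qed (simp add: matrix_vector_mult_scaleR power2_eq_square)
  moreover have "\<forall>\<^sub>F b in at_top. \<forall>c\<in>X. \<forall>v. (norm (v v* A c))\<^sup>2 \<le> b * (v \<bullet> (R c *v v))"
  proof (intro eventually_ball_finite[OF \<open>finite X\<close>] ballI quadratic_form_bound)
    fix c show "continuous_on UNIV (\<lambda>v. (norm (v v* A c))\<^sup>2)"
      unfolding vA
      by (intro continuous_intros linear_continuous_on matrix_vector_mul_bounded_linear)
  qed (use pos in \<open>simp_all add: vA matrix_vector_mult_scaleR power_mult_distrib
      del: transpose_matrix_vector\<close>)
  moreover have "\<forall>\<^sub>F b :: real in at_top. b > 1" by (rule eventually_gt_at_top)
  ultimately have "\<forall>\<^sub>F b in at_top. (\<forall>c\<in>X. \<forall>v. v \<bullet> (R c *v v)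
      \<le> b * (v \<bullet> ((R c - A c ** D c ** transpose (A c)) *v v)))
      \<and> (\<forall>c\<in>X. \<forall>v. (norm (v v* A c))\<^sup>2 \<le> b * (v \<bullet> (R c *v v))) \<and> b > 1"
    by eventually_elim blast
  then obtain b :: real where 1: "\<forall>c\<in>X. \<forall>v. v \<bullet> (R c *v v)
      \<le> b * (v \<bullet> ((R c - A c ** D c ** transpose (A c)) *v v))"
      and 2: "\<forall>c\<in>X. \<forall>v. (norm (v v* A c))\<^sup>2 \<le> b * (v \<bullet> (R c *v v))" and b: "b > 1"
    using eventually_happens'[OF trivial_limit_at_top_linorder] by blast
  \<comment> \<open>Dividing \<open>R \<le> b (R - A D A^T)\<close> by \<open>b\<close> and
    rearranging gives \<open>A D A^T \<le> (1 - 1/b) R\<close>; \<open>b > 1\<close> puts the rate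
    strictly between 0 and 1.\<close>
  show thesis
  proof (rule that[of "1 - 1 / b" b])
    fix c v assume c: "c \<in> X"
    have "v \<bullet> (R c *v v) \<le> b * (v \<bullet> (R c *v v) - (v v* A c) \<bullet> (D c *v (v v* A c)))"
      using 1[rule_format, OF c, of v]
      by (simp add: matrix_vector_mult_diff_rdistrib inner_diff_right dot_lmul_matrix
          matrix_vector_mul_assoc[symmetric])
    then show "(v v* A c) \<bullet> (D c *v (v v* A c)) \<le> (1 - 1 / b) * (v \<bullet> (R c *v v))"
      using b by (simp add: field_simps)
  next
    fix c and v x :: "real^'n" assume c: "c \<in> X"
    have "(v \<bullet> (A c *v x))\<^sup>2 = ((v v* A c) \<bullet> x)\<^sup>2" by (simp add: dot_lmul_matrix)
    also have "\<dots> \<le> (norm (v v* A c))\<^sup>2 * (norm x)\<^sup>2"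
      using Cauchy_Schwarz_ineq[of "v v* A c" x] by (simp add: power2_norm_eq_inner)
    also have "\<dots> \<le> b * (v \<bullet> (R c *v v)) * (norm x)\<^sup>2"
      using 2[rule_format, OF c, of v] by (intro mult_right_mono) auto
    finally show "(v \<bullet> (A c *v x))\<^sup>2 \<le> b * (norm x)\<^sup>2 * (v \<bullet> (R c *v v))"
      by (simp add: mult_ac)
  qed (use b in auto)
qed

subsection \<open>The observation process along a sample path\<close>

text \<open>A finite infimum of a set of times is attained, hence every finite observation time is
  an observed instant. Conversely, strong induction reaches each observed instant from the one
  before it.\<close>

lemma range_obs_time: "enat j \<in> range (obs_time f s) \<longleftrightarrow> f (s j) = 1"
proof
  have mem: "i \<in> S" if "Inf (enat ` S) = enat i" for S i
  proof -
    have "S \<noteq> {}" using that by (auto simp: Inf_enat_def)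
    then have "Inf (enat ` S) \<in> enat ` S"
      unfolding Inf_enat_def by (auto intro: LeastI)
    then show ?thesis using that by auto
  qed
  assume "enat j \<in> range (obs_time f s)"
  then obtain i where "obs_time f s i = enat j" by (metis imageE)
  then show "f (s j) = 1" by (cases i) (auto dest: mem)
next
  have Inf_eq: "Inf (enat ` S) = enat i" if "i \<in> S" "\<And>k. k \<in> S \<Longrightarrow> i \<le> k" for S i
    using that by (intro antisym Inf_lower Inf_greatest) auto
  show "f (s j) = 1 \<Longrightarrow> enat j \<in> range (obs_time f s)"
  proof (induction j rule: less_induct)
    case (less j)
    let ?S = "{k. k < j \<and> f (s k) = 1}"
    show ?case
    proof (cases "?S = {}")
      case True
      then have "obs_time f s 0 = enat j"
        using less.prems unfolding obs_time.simps by (intro Inf_eq) (auto simp: not_less[symmetric])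
      then show ?thesis by (metis rangeI)
    next
      case False
      \<comment> \<open>The latest observation before \<open>j\<close>: if it has index
        \<open>i\<close>, nothing is observed in between, so \<open>j\<close> has index
        \<open>Suc i\<close>.\<close>
      define j' where "j' = Max ?S"
      have j': "j' \<in> ?S" unfolding j'_def using False by (intro Max_in) auto
      have max: "k \<le> j'" if "k < j" "f (s k) = 1" for k
        unfolding j'_def using that by (intro Max_ge) auto
      have "enat j' \<in> range (obs_time f s)" using j' less.IH by blast
      then obtain i where i: "obs_time f s i = enat j'" by (metis imageE)
      have "obs_time f s (Suc i) = enat j"
        unfolding obs_time.simps i using less.prems j'
      proof (intro Inf_eq)
        fix k assume "k \<in> {k. enat j' < enat k \<and> f (s k) = 1}"
        then show "j \<le> k" using max[of k] by (auto simp: not_less[symmetric])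
      qed auto
      then show ?thesis by (metis rangeI)
    qed
  qed
qed

lemma less_obs_time_0: "enat k < obs_time f s 0 \<longleftrightarrow> (\<forall>j\<le>k. f (s j) \<noteq> 1)"
proof -
  have "obs_time f s 0 \<le> enat k \<longleftrightarrow> (\<exists>j\<le>k. f (s j) = 1)"
  proof
    assume *: "obs_time f s 0 \<le> enat k"
    then obtain j where j: "obs_time f s 0 = enat j" by (cases "obs_time f s 0") auto
    then have "enat j \<in> range (obs_time f s)" by (metis rangeI)
    with * j show "\<exists>j\<le>k. f (s j) = 1" unfolding range_obs_time by auto
  next
    assume "\<exists>j\<le>k. f (s j) = 1"
    then obtain j where j: "j \<le> k" "f (s j) = 1" by blast
    then have "obs_time f s 0 \<le> enat j" by (auto intro: Inf_lower)
    also have "enat j \<le> enat k" using j by simp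
    finally show "obs_time f s 0 \<le> enat k" .
  qed
  then show ?thesis by (metis not_le)
qed

text \<open>An explicit finite set in place of the recursive observation times: the latest
  observation becomes a maximum, and dependence on the past alone becomes visible.\<close>

definition past_obs :: "('j \<Rightarrow> nat) \<Rightarrow> (nat \<Rightarrow> 'j) \<Rightarrow> nat \<Rightarrow> nat set" where
  "past_obs f s k = {j. j \<le> k \<and> f (s j) = 1}"

lemma finite_past_obs: "finite (past_obs f s k)"
  by (simp add: past_obs_def)

lemma obs_tau_eq:
  "obs_tau f \<tau>0 s k = (if past_obs f s k = {} then \<tau>0 else int (Max (past_obs f s k)))"
  unfolding obs_tau_def less_obs_time_0 range_obs_time past_obs_def by auto

lemma obs_sigma_eq:
  "obs_sigma f \<tau>0 \<sigma>0 r s k =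
     (if past_obs f s k = {} then \<sigma>0 else r (Max (past_obs f s k)))"
  unfolding obs_sigma_def less_obs_time_0 obs_tau_eq past_obs_def by auto

lemma obs_observed:
  assumes "f (s k) = 1"
  shows "obs_tau f \<tau>0 s k = int k" "obs_sigma f \<tau>0 \<sigma>0 r s k = r k" "obs_rho f T \<tau>0 s k = 1"
proof -
  have "k \<in> past_obs f s k" "Max (past_obs f s k) = k"
    using assms finite_past_obs[of f s k] by (auto simp: past_obs_def intro!: Max_eqI)
  then show "obs_tau f \<tau>0 s k = int k" "obs_sigma f \<tau>0 \<sigma>0 r s k = r k"
    by (auto simp: obs_tau_eq obs_sigma_eq)
  then show "obs_rho f T \<tau>0 s k = 1" by (simp add: obs_rho_def)
qed

text \<open>The set of past observations does not grow, so its maximum, or the initial value if it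
  is empty, persists.\<close>

lemma obs_unobserved:
  assumes "f (s (Suc k)) \<noteq> 1"
  shows "obs_tau f \<tau>0 s (Suc k) = obs_tau f \<tau>0 s k"
    and "obs_sigma f \<tau>0 \<sigma>0 r s (Suc k) = obs_sigma f \<tau>0 \<sigma>0 r s k"
proof -
  have "past_obs f s (Suc k) = past_obs f s k"
    using assms by (auto simp: past_obs_def le_Suc_eq)
  then show "obs_tau f \<tau>0 s (Suc k) = obs_tau f \<tau>0 s k"
    and "obs_sigma f \<tau>0 \<sigma>0 r s (Suc k) = obs_sigma f \<tau>0 \<sigma>0 r s k"
    by (simp_all add: obs_tau_eq obs_sigma_eq)
qed

text \<open>The extended chain as a function of two arbitrary sequences rather than of a sample
  point, so that its dependence on a finite prefix can be expressed.\<close>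

definition ext_mode_path ::
  "('j \<Rightarrow> nat) \<Rightarrow> nat \<Rightarrow> int \<Rightarrow> 'i \<Rightarrow> (nat \<Rightarrow> 'i) \<Rightarrow> (nat \<Rightarrow> 'j) \<Rightarrow> nat \<Rightarrow> 'i \<times> 'j \<times> 'i \<times> nat" where
  "ext_mode_path f T \<tau>0 \<sigma>0 r s k =
     (r k, s k, obs_sigma f \<tau>0 \<sigma>0 r s k, obs_rho f T \<tau>0 s k)"

lemma ext_mode_path_mem: "T > 0 \<Longrightarrow> ext_mode_path f T \<tau>0 \<sigma>0 r s k \<in> ext_modes f T"
  by (auto simp: ext_mode_path_def ext_modes_def obs_observed[unfolded One_nat_def])
     (auto simp: obs_rho_def Suc_le_eq nat_less_iff)

text \<open>The extended mode is nonanticipative: the last observation up to time \<open>k\<close>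
  is itself at most \<open>k\<close>. This permits finite sums over prefixes in place of conditional
  expectations.\<close>

lemma ext_mode_path_cong:
  assumes "\<And>i. i \<le> k \<Longrightarrow> r i = r' i" "\<And>i. i \<le> k \<Longrightarrow> s i = s' i"
  shows "ext_mode_path f T \<tau>0 \<sigma>0 r s k = ext_mode_path f T \<tau>0 \<sigma>0 r' s' k"
proof -
  have eq: "past_obs f s k = past_obs f s' k" using assms(2) by (auto simp: past_obs_def)
  have "Max (past_obs f s' k) \<le> k" if "past_obs f s' k \<noteq> {}"
    using Max_in[OF finite_past_obs that] by (simp add: past_obs_def)
  with eq show ?thesis
    using assms by (auto simp: ext_mode_path_def obs_sigma_eq obs_rho_def obs_tau_eq)
qed

text \<open>Along any path the indicator in \<open>ext_trans\<close> equals one: an observation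
  resets the last two components, and otherwise the estimate is kept while the counter advances
  cyclically.\<close>

lemma ext_trans_path:
  assumes "T > 0"
  shows "ext_trans p q f T (ext_mode_path f T \<tau>0 \<sigma>0 r s k) (ext_mode_path f T \<tau>0 \<sigma>0 r s (Suc k))
    = p (r k) (r (Suc k)) * q (s k) (s (Suc k))"
proof (cases "f (s (Suc k)) = 1")
  case True
  then show ?thesis by (simp add: ext_mode_path_def obs_observed)
next
  case False
  define a where "a = int k - obs_tau f \<tau>0 s k"
  define b where "b = a mod int T"
  \<comment> \<open>With \<open>b\<close> the residue at time \<open>k\<close>, the counter is
    \<open>b + 1\<close>. Its increment minus one is the difference between a residue of
    \<open>b + 1\<close> and \<open>b + 1\<close>, a multiple of \<open>T\<close>.\<close>
  have "(a + 1) mod int T = (b + 1) mod int T" unfolding b_def by (simp only: mod_add_left_eq)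
  then have "int (obs_rho f T \<tau>0 s (Suc k)) - int (obs_rho f T \<tau>0 s k) - 1
      = (b + 1) mod int T - (b + 1)"
    using assms False
    by (simp add: obs_rho_def obs_unobserved a_def b_def algebra_simps)
  also have "\<dots> mod int T = 0" unfolding mod_diff_left_eq by simp
  finally show ?thesis using False by (simp add: ext_mode_path_def obs_unobserved)
qed

subsection \<open>The Markov property for functions of finite paths\<close>

text \<open>The conditional law is turned into a product. For a null conditioning event the
  conditional law says nothing, but both sides vanish by monotonicity.\<close>

lemma markov_chain_cylinder:
  assumes "prob_space \<Omega>" and X: "markov_chain \<Omega> X p x0"
  shows "\<P>(\<omega> in \<Omega>. \<forall>i\<le>Suc k. X i \<omega> = h i)
    = \<P>(\<omega> in \<Omega>. \<forall>i\<le>k. X i \<omega> = h i) * p (h k) (h (Suc k))"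
proof -
  interpret prob_space \<Omega> by fact
  have [measurable]: "X i \<in> measurable \<Omega> (count_space UNIV)" for i
    using X by (simp add: markov_chain_def)
  have le: "\<P>(\<omega> in \<Omega>. \<forall>i\<le>Suc k. X i \<omega> = h i) \<le> \<P>(\<omega> in \<Omega>. \<forall>i\<le>k. X i \<omega> = h i)"
    by (intro finite_measure_mono) auto
  have eq: "(X (Suc k) \<omega> = h (Suc k) \<and> (\<forall>i\<le>k. X i \<omega> = h i)) \<longleftrightarrow> (\<forall>i\<le>Suc k. X i \<omega> = h i)"
    for \<omega> by (auto simp: le_Suc_eq)
  show ?thesis
  proof (cases "\<P>(\<omega> in \<Omega>. \<forall>i\<le>k. X i \<omega> = h i) > 0")
    case True
    then have "\<P>(\<omega> in \<Omega>. X (Suc k) \<omega> = h (Suc k) \<bar> \<forall>i\<le>k. X i \<omega> = h i) = p (h k) (h (Suc k))"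
      using X unfolding markov_chain_def by blast
    with True show ?thesis unfolding cond_prob_def eq by (simp add: field_simps)
  next
    case False
    then have "\<P>(\<omega> in \<Omega>. \<forall>i\<le>k. X i \<omega> = h i) = 0"
      by (simp add: zero_less_measure_iff)
    with le show ?thesis by (simp add: measure_le_0_iff)
  qed
qed

text \<open>Independence is stated for the generated algebras. A cylinder constrains finitely many
  coordinates, so it is the preimage of a measurable set of sequences.\<close>

lemma cylinder_in_generated_algebra:
  fixes X :: "nat \<Rightarrow> 'w \<Rightarrow> 'a::finite"
  shows
  "{\<omega> \<in> space \<Omega>. \<forall>i\<le>k. X i \<omega> = h i}
     \<in> sets (vimage_algebra (space \<Omega>) (\<lambda>\<omega> k. X k \<omega>) (Pi\<^sub>M UNIV (\<lambda>_. count_space (UNIV :: 'a set))))"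
proof -
  have "{x \<in> space (Pi\<^sub>M UNIV (\<lambda>_. count_space (UNIV :: 'a set))). \<forall>i\<le>k. x i = h i}
      \<in> sets (Pi\<^sub>M UNIV (\<lambda>_. count_space (UNIV :: 'a set)))"
    unfolding Ball_def[symmetric] atMost_iff[symmetric] pred_def[symmetric]
    by (intro pred_intros_finite pred_count_space_const1 measurable_component_singleton) auto
  from in_vimage_algebra[OF this, of "\<lambda>\<omega> k. X k \<omega>" "space \<Omega>"] show ?thesis
    by (rule back_subst[of "\<lambda>A. A \<in> _"]) (auto simp: space_PiM)
qed

lemma realization_cylinder:
  assumes "realization \<Omega> r s p q r0 s0"
  shows "\<P>(\<omega> in \<Omega>. (\<forall>i\<le>k. r i \<omega> = h i) \<and> (\<forall>i\<le>k. s i \<omega> = g i))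
    = \<P>(\<omega> in \<Omega>. \<forall>i\<le>k. r i \<omega> = h i) * \<P>(\<omega> in \<Omega>. \<forall>i\<le>k. s i \<omega> = g i)"
proof -
  interpret prob_space \<Omega> using assms by (simp add: realization_def)
  have "prob ({\<omega> \<in> space \<Omega>. \<forall>i\<le>k. r i \<omega> = h i} \<inter> {\<omega> \<in> space \<Omega>. \<forall>i\<le>k. s i \<omega> = g i})
    = \<P>(\<omega> in \<Omega>. \<forall>i\<le>k. r i \<omega> = h i) * \<P>(\<omega> in \<Omega>. \<forall>i\<le>k. s i \<omega> = g i)"
    using assms unfolding realization_def
    by (intro indep_setD[OF _ cylinder_in_generated_algebra cylinder_in_generated_algebra]) blast
  also have "{\<omega> \<in> space \<Omega>. \<forall>i\<le>k. r i \<omega> = h i} \<inter> {\<omega> \<in> space \<Omega>. \<forall>i\<le>k. s i \<omega> = g i}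
    = {\<omega> \<in> space \<Omega>. (\<forall>i\<le>k. r i \<omega> = h i) \<and> (\<forall>i\<le>k. s i \<omega> = g i)}" by auto
  finally show ?thesis .
qed

lemma realization_cylinder_Suc:
  assumes real: "realization \<Omega> r s p q r0 s0" and st: "stochastic p" "stochastic q"
  shows "emeasure \<Omega> {\<omega> \<in> space \<Omega>. (\<forall>i\<le>Suc k. r i \<omega> = h i) \<and> (\<forall>i\<le>Suc k. s i \<omega> = g i)}
    = ennreal (p (h k) (h (Suc k)) * q (g k) (g (Suc k))) *
      emeasure \<Omega> {\<omega> \<in> space \<Omega>. (\<forall>i\<le>k. r i \<omega> = h i) \<and> (\<forall>i\<le>k. s i \<omega> = g i)}"
proof -
  interpret prob_space \<Omega> using real by (simp add: realization_def)
  have mc: "markov_chain \<Omega> r p r0" "markov_chain \<Omega> s q s0"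
    using real by (simp_all add: realization_def)
  have "0 \<le> p (h k) (h (Suc k)) * q (g k) (g (Suc k))"
    using st by (simp add: stochastic_def)
  then show ?thesis
    unfolding emeasure_eq_measure realization_cylinder[OF real]
    by (simp add: markov_chain_cylinder[OF prob_space_axioms mc(1)]
       markov_chain_cylinder[OF prob_space_axioms mc(2)] mult_ac flip: ennreal_mult)
qed

text \<open>A function of a prefix takes finitely many values and is a simple function on cylinders.
  The set \<open>B\<close> leaves room for an event at the following time.\<close>

lemma path_function_eq_sum:
  fixes r :: "nat \<Rightarrow> 'w \<Rightarrow> 'i::finite" and s :: "nat \<Rightarrow> 'w \<Rightarrow> 'j::finite"
    and \<phi> :: "(nat \<Rightarrow> 'i) \<Rightarrow> (nat \<Rightarrow> 'j) \<Rightarrow> ennreal"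
  assumes \<phi>: "\<And>h h' g g'. \<forall>i\<le>k. h i = h' i \<and> g i = g' i \<Longrightarrow> \<phi> h g = \<phi> h' g'"
    and \<omega>: "\<omega> \<in> space \<Omega>"
  shows "\<phi> (\<lambda>i. r i \<omega>) (\<lambda>i. s i \<omega>) * indicator B \<omega>
    = (\<Sum>(h, g) \<in> ({..k} \<rightarrow>\<^sub>E UNIV) \<times> ({..k} \<rightarrow>\<^sub>E UNIV). \<phi> h g * indicator
        {\<omega> \<in> space \<Omega>. ((\<forall>i\<le>k. r i \<omega> = h i) \<and> (\<forall>i\<le>k. s i \<omega> = g i)) \<and> \<omega> \<in> B} \<omega>)"
proof -
  let ?H = "({..k} \<rightarrow>\<^sub>E (UNIV :: 'i set)) \<times> ({..k} \<rightarrow>\<^sub>E (UNIV :: 'j set))"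
  let ?C = "\<lambda>h g. {\<omega> \<in> space \<Omega>. ((\<forall>i\<le>k. r i \<omega> = h i) \<and> (\<forall>i\<le>k. s i \<omega> = g i)) \<and> \<omega> \<in> B}"
  \<comment> \<open>Members of the index set are fixed to \<open>undefined\<close> beyond
    \<open>k\<close>, so exactly one pair of prefixes matches the sample path.\<close>
  let ?h = "restrict (\<lambda>i. r i \<omega>) {..k}" and ?g = "restrict (\<lambda>i. s i \<omega>) {..k}"
  have fin: "finite ?H" by (intro finite_SigmaI finite_PiE) auto
  have "(\<Sum>(h, g) \<in> ?H. \<phi> h g * indicator (?C h g) \<omega>)
      = (\<Sum>(h, g) \<in> {(?h, ?g)}. \<phi> h g * indicator (?C h g) \<omega>)"
  proof (rule sum.mono_neutral_right[OF fin])
    show "\<forall>x \<in> ?H - {(?h, ?g)}. (case x of (h, g) \<Rightarrow> \<phi> h g * indicator (?C h g) \<omega>) = 0"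
    proof
      fix x assume x: "x \<in> ?H - {(?h, ?g)}"
      then obtain h g where hg: "x = (h, g)" "h \<in> {..k} \<rightarrow>\<^sub>E UNIV" "g \<in> {..k} \<rightarrow>\<^sub>E UNIV" by auto
      have "\<omega> \<notin> ?C h g"
      proof
        assume "\<omega> \<in> ?C h g"
        then have "h = ?h" "g = ?g"
          using hg by (auto intro!: PiE_ext[of _ "{..k}" "\<lambda>_. UNIV"])
        with x hg show False by blast
      qed
      then show "(case x of (h, g) \<Rightarrow> \<phi> h g * indicator (?C h g) \<omega>) = 0"
        by (simp add: hg(1))
    qed
  qed auto
  also have "\<dots> = \<phi> ?h ?g * indicator B \<omega>" using \<omega> by (simp add: indicator_def)
  also have "\<phi> ?h ?g = \<phi> (\<lambda>i. r i \<omega>) (\<lambda>i. s i \<omega>)" by (rule \<phi>) auto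
  finally show ?thesis ..
qed

lemma path_function_measurable:
  fixes r :: "nat \<Rightarrow> 'w \<Rightarrow> 'i::finite" and s :: "nat \<Rightarrow> 'w \<Rightarrow> 'j::finite"
    and \<phi> :: "(nat \<Rightarrow> 'i) \<Rightarrow> (nat \<Rightarrow> 'j) \<Rightarrow> ennreal"
  assumes [measurable]: "\<And>i. r i \<in> measurable \<Omega> (count_space UNIV)"
      "\<And>i. s i \<in> measurable \<Omega> (count_space UNIV)"
    and \<phi>: "\<And>h h' g g'. \<forall>i\<le>k. h i = h' i \<and> g i = g' i \<Longrightarrow> \<phi> h g = \<phi> h' g'"
  shows "(\<lambda>\<omega>. \<phi> (\<lambda>i. r i \<omega>) (\<lambda>i. s i \<omega>)) \<in> borel_measurable \<Omega>"
proof (subst measurable_cong)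
  fix \<omega> assume "\<omega> \<in> space \<Omega>"
  then show "\<phi> (\<lambda>i. r i \<omega>) (\<lambda>i. s i \<omega>)
    = (\<Sum>(h, g) \<in> ({..k} \<rightarrow>\<^sub>E UNIV) \<times> ({..k} \<rightarrow>\<^sub>E UNIV). \<phi> h g * indicator
        {\<omega> \<in> space \<Omega>. ((\<forall>i\<le>k. r i \<omega> = h i) \<and> (\<forall>i\<le>k. s i \<omega> = g i)) \<and> \<omega> \<in> UNIV} \<omega>)"
    using path_function_eq_sum[where B = UNIV, OF \<phi>] by simp
qed (simp add: case_prod_beta)

lemma nn_integral_path_sum:
  fixes r :: "nat \<Rightarrow> 'w \<Rightarrow> 'i::finite" and s :: "nat \<Rightarrow> 'w \<Rightarrow> 'j::finite"
    and \<phi> :: "(nat \<Rightarrow> 'i) \<Rightarrow> (nat \<Rightarrow> 'j) \<Rightarrow> ennreal"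
  assumes [measurable]: "\<And>i. r i \<in> measurable \<Omega> (count_space UNIV)"
      "\<And>i. s i \<in> measurable \<Omega> (count_space UNIV)"
    and \<phi>: "\<And>h h' g g'. \<forall>i\<le>k. h i = h' i \<and> g i = g' i \<Longrightarrow> \<phi> h g = \<phi> h' g'"
    and B[measurable]: "B \<in> sets \<Omega>"
  shows "(\<integral>\<^sup>+\<omega>. \<phi> (\<lambda>i. r i \<omega>) (\<lambda>i. s i \<omega>) * indicator B \<omega> \<partial>\<Omega>)
    = (\<Sum>(h, g) \<in> ({..k} \<rightarrow>\<^sub>E UNIV) \<times> ({..k} \<rightarrow>\<^sub>E UNIV). \<phi> h g *
        emeasure \<Omega> {\<omega> \<in> space \<Omega>. ((\<forall>i\<le>k. r i \<omega> = h i) \<and> (\<forall>i\<le>k. s i \<omega> = g i)) \<and> \<omega> \<in> B})"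
proof -
  have "(\<integral>\<^sup>+\<omega>. \<phi> (\<lambda>i. r i \<omega>) (\<lambda>i. s i \<omega>) * indicator B \<omega> \<partial>\<Omega>)
      = (\<integral>\<^sup>+\<omega>. (\<Sum>(h, g) \<in> ({..k} \<rightarrow>\<^sub>E UNIV) \<times> ({..k} \<rightarrow>\<^sub>E UNIV). \<phi> h g * indicator
        {\<omega> \<in> space \<Omega>. ((\<forall>i\<le>k. r i \<omega> = h i) \<and> (\<forall>i\<le>k. s i \<omega> = g i)) \<and> \<omega> \<in> B} \<omega>) \<partial>\<Omega>)"
    by (rule nn_integral_cong) (rule path_function_eq_sum[OF \<phi>])
  also have "\<dots> = (\<Sum>(h, g) \<in> ({..k} \<rightarrow>\<^sub>E UNIV) \<times> ({..k} \<rightarrow>\<^sub>E UNIV). \<phi> h g *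
        emeasure \<Omega> {\<omega> \<in> space \<Omega>. ((\<forall>i\<le>k. r i \<omega> = h i) \<and> (\<forall>i\<le>k. s i \<omega> = g i)) \<and> \<omega> \<in> B})"
    by (auto simp: case_prod_beta nn_integral_sum nn_integral_cmult_indicator)
  finally show ?thesis .
qed

text \<open>The one-step Markov property of the pair \<open>(r, s)\<close>, obtained without
  conditional expectations: both integrals expand over prefixes, and the terms agree by the product
  formula for cylinders.\<close>

lemma realization_Markov:
  fixes r :: "nat \<Rightarrow> 'w \<Rightarrow> 'i::finite" and s :: "nat \<Rightarrow> 'w \<Rightarrow> 'j::finite"
    and \<phi> :: "(nat \<Rightarrow> 'i) \<Rightarrow> (nat \<Rightarrow> 'j) \<Rightarrow> ennreal"
  assumes real: "realization \<Omega> r s p q r0 s0" and st: "stochastic p" "stochastic q"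
    and \<phi>: "\<And>h h' g g'. \<forall>i\<le>k. h i = h' i \<and> g i = g' i \<Longrightarrow> \<phi> h g = \<phi> h' g'"
  shows "(\<integral>\<^sup>+\<omega>. \<phi> (\<lambda>i. r i \<omega>) (\<lambda>i. s i \<omega>)
        * indicator {\<omega> \<in> space \<Omega>. r (Suc k) \<omega> = a \<and> s (Suc k) \<omega> = b} \<omega> \<partial>\<Omega>)
    = (\<integral>\<^sup>+\<omega>. \<phi> (\<lambda>i. r i \<omega>) (\<lambda>i. s i \<omega>) * ennreal (p (r k \<omega>) a * q (s k \<omega>) b) \<partial>\<Omega>)"
proof -
  have rv[measurable]: "r i \<in> measurable \<Omega> (count_space UNIV)"
    and rv'[measurable]: "s i \<in> measurable \<Omega> (count_space UNIV)" for i
    using real by (simp_all add: realization_def markov_chain_def)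
  have B: "{\<omega> \<in> space \<Omega>. r (Suc k) \<omega> = a \<and> s (Suc k) \<omega> = b} \<in> sets \<Omega>"
    by measurable
  \<comment> \<open>Prescribing the values at \<open>Suc k\<close> turns a cylinder of a prefix into
    the cylinder of the prolonged prefix.\<close>
  have ext: "{\<omega> \<in> space \<Omega>. ((\<forall>i\<le>k. r i \<omega> = h i) \<and> (\<forall>i\<le>k. s i \<omega> = g i)) \<and>
        \<omega> \<in> {\<omega> \<in> space \<Omega>. r (Suc k) \<omega> = a \<and> s (Suc k) \<omega> = b}}
      = {\<omega> \<in> space \<Omega>. (\<forall>i\<le>Suc k. r i \<omega> = (h(Suc k := a)) i) \<and> (\<forall>i\<le>Suc k. s i \<omega> = (g(Suc k := b)) i)}"
    for h g by (auto simp: le_Suc_eq)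
  have sp: "{\<omega> \<in> space \<Omega>. Q \<omega> \<and> \<omega> \<in> space \<Omega>} = {\<omega> \<in> space \<Omega>. Q \<omega>}" for Q by auto
  have cong: "(\<forall>i\<le>k. x i = (y(Suc k := z)) i) \<longleftrightarrow> (\<forall>i\<le>k. x i = y i)" for x y :: "nat \<Rightarrow> 'c" and z
    by auto
  define \<psi> where "\<psi> h g = \<phi> h g * ennreal (p (h k) a * q (g k) b)" for h g
  have \<psi>: "\<psi> h g = \<psi> h' g'" if "\<forall>i\<le>k. h i = h' i \<and> g i = g' i" for h h' g g'
    unfolding \<psi>_def using that \<phi>[OF that] by simp
  have "(\<integral>\<^sup>+\<omega>. \<phi> (\<lambda>i. r i \<omega>) (\<lambda>i. s i \<omega>)
        * indicator {\<omega> \<in> space \<Omega>. r (Suc k) \<omega> = a \<and> s (Suc k) \<omega> = b} \<omega> \<partial>\<Omega>)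
      = (\<Sum>(h, g) \<in> ({..k} \<rightarrow>\<^sub>E UNIV) \<times> ({..k} \<rightarrow>\<^sub>E UNIV). \<psi> h g *
        emeasure \<Omega> {\<omega> \<in> space \<Omega>. (\<forall>i\<le>k. r i \<omega> = h i) \<and> (\<forall>i\<le>k. s i \<omega> = g i)})"
    by (rule trans[OF nn_integral_path_sum[of r \<Omega> s k \<phi>, OF rv rv' _ B]], erule \<phi>,
        intro sum.cong refl, clarify,
        simp only: ext realization_cylinder_Suc[OF real st] cong, simp add: \<psi>_def mult.assoc)
  \<comment> \<open>The same expansion read backwards, with the transition probability absorbed into
    \<open>\<psi>\<close> and the whole space as event.\<close>
  also have "\<dots> = (\<integral>\<^sup>+\<omega>. \<psi> (\<lambda>i. r i \<omega>) (\<lambda>i. s i \<omega>) * indicator (space \<Omega>) \<omega> \<partial>\<Omega>)"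
    by (rule trans[OF _ nn_integral_path_sum[of r \<Omega> s k \<psi>, OF rv rv' _ sets.top, symmetric]],
        intro sum.cong refl, clarify, simp only: sp, erule \<psi>)
  also have "\<dots> = (\<integral>\<^sup>+\<omega>. \<psi> (\<lambda>i. r i \<omega>) (\<lambda>i. s i \<omega>) \<partial>\<Omega>)"
    by (rule nn_integral_cong) simp
  finally show ?thesis by (simp add: \<psi>_def)
qed

subsection \<open>Decay of second moments\<close>

lemma finite_ext_modes: "finite (ext_modes f T :: ('i::finite \<times> 'j::finite \<times> 'i \<times> nat) set)"
proof (rule finite_subset)
  show "ext_modes f T \<subseteq> UNIV \<times> UNIV \<times> UNIV \<times> {1..T}" by (auto simp: ext_modes_def)
qed (intro finite_SigmaI, auto)

lemma ext_trans_nonneg: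
  "\<lbrakk>stochastic p; stochastic q\<rbrakk> \<Longrightarrow> ext_trans p q f T c c' \<ge> 0"
  by (cases c; cases c') (simp add: stochastic_def)

lemma ext_D_quadratic_form:
  fixes R :: "'i \<times> 'j \<times> 'i \<times> nat \<Rightarrow> real^'n::finite^'n"
  shows "x \<bullet> (ext_D p q f T R c *v x)
    = (\<Sum>c'\<in>ext_modes f T. ext_trans p q f T c' c * (x \<bullet> (R c' *v x)))"
proof -
  have sum_mv: "sum M S *v x = (\<Sum>c\<in>S. M c *v x)" for M :: "'c \<Rightarrow> real^'n^'n" and S
    by (induction S rule: infinite_finite_induct) (simp_all add: matrix_vector_mult_add_rdistrib)
  show ?thesis
    by (simp add: ext_D_def sum_mv inner_sum_right scaleR_matrix_vector_assoc[symmetric])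
qed

lemma transpose_ext_D:
  assumes "\<And>c'. c' \<in> ext_modes f T \<Longrightarrow> transpose (R c') = R c'"
  shows "transpose (ext_D p q f T R c) = ext_D p q f T R c"
proof -
  have sym: "R c' $ i $ j = R c' $ j $ i" if "c' \<in> ext_modes f T" for c' i j
  proof -
    have "transpose (R c') $ i $ j = R c' $ i $ j" using assms that by simp
    then show ?thesis by (simp add: transpose_def)
  qed
  show ?thesis
    by (simp add: vec_eq_iff transpose_def ext_D_def)
       (intro allI sum.cong refl, simp add: sym)
qed

section \<open>The closed loop as a function of mode sequences\<close>

fun closed_loop_matrix ::
  "('i, 'n::finite, 'm::finite, 'l::finite, 'q::finite) jump_system \<Rightarrow>
   ('i \<Rightarrow> nat \<Rightarrow> real^'n^'m) \<Rightarrow> 'i \<times> 'j \<times> 'i \<times> nat \<Rightarrow> real^'n^'n" where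
  "closed_loop_matrix Sys K (\<alpha>, \<beta>, \<gamma>, \<delta>) = mat_A Sys \<alpha> + mat_B Sys \<alpha> ** K \<gamma> \<delta>"

abbreviation undisturbed_state ::
  "('i, 'n::finite, 'm::finite, 'l::finite, 'q::finite) jump_system \<Rightarrow>
   ('i \<Rightarrow> nat \<Rightarrow> real^'n^'m) \<Rightarrow> ('j \<Rightarrow> nat) \<Rightarrow> nat \<Rightarrow> int \<Rightarrow> 'i \<Rightarrow> real^'n \<Rightarrow>
   (nat \<Rightarrow> 'i) \<Rightarrow> (nat \<Rightarrow> 'j) \<Rightarrow> nat \<Rightarrow> real^'n" where
  "undisturbed_state Sys K f T \<tau>0 \<sigma>0 x0 r s \<equiv>
     closed_loop_state Sys K r (obs_sigma f \<tau>0 \<sigma>0 r s) (obs_rho f T \<tau>0 s) (\<lambda>_. 0) x0"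

lemma undisturbed_state_Suc:
  "undisturbed_state Sys K f T \<tau>0 \<sigma>0 x0 r s (Suc k)
    = closed_loop_matrix Sys K (ext_mode_path f T \<tau>0 \<sigma>0 r s k)
        *v undisturbed_state Sys K f T \<tau>0 \<sigma>0 x0 r s k"
  by (simp add: ext_mode_path_def)

text \<open>The bound \<open>i < k\<close> is strict: the state at \<open>Suc k\<close> is
  determined by the modes up to \<open>k\<close>, so it can be paired with the extended mode at time
  \<open>k\<close> as a function of the same prefix.\<close>

lemma undisturbed_state_cong:
  assumes "\<forall>i<k. r i = r' i \<and> s i = s' i"
  shows "undisturbed_state Sys K f T \<tau>0 \<sigma>0 x0 r s k
    = undisturbed_state Sys K f T \<tau>0 \<sigma>0 x0 r' s' k"
  using assms
proof (induction k)
  case (Suc k)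
  then have "ext_mode_path f T \<tau>0 \<sigma>0 r s k = ext_mode_path f T \<tau>0 \<sigma>0 r' s' k"
    by (intro ext_mode_path_cong) auto
  with Suc show ?case unfolding undisturbed_state_Suc by simp
qed simp

text \<open>One step of the extended chain, weighted by a function of the past that lives on mode
  \<open>c\<close>. An inequality is enough for an upper bound on moments and spares a proof that
  the extended process is a Markov chain.\<close>

lemma ext_mode_step_le:
  fixes r :: "nat \<Rightarrow> 'w \<Rightarrow> 'i::finite" and s :: "nat \<Rightarrow> 'w \<Rightarrow> 'j::finite"
    and \<phi> :: "(nat \<Rightarrow> 'i) \<Rightarrow> (nat \<Rightarrow> 'j) \<Rightarrow> ennreal"
  assumes real: "realization \<Omega> r s p q r0 s0" and st: "stochastic p" "stochastic q" and T: "T > 0"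
    and \<phi>: "\<And>h h' g g'. \<forall>i\<le>k. h i = h' i \<and> g i = g' i \<Longrightarrow> \<phi> h g = \<phi> h' g'"
    and supp: "\<And>h g. ext_mode_path f T \<tau>0 \<sigma>0 h g k \<noteq> c \<Longrightarrow> \<phi> h g = 0"
  shows "(\<integral>\<^sup>+\<omega>. \<phi> (\<lambda>i. r i \<omega>) (\<lambda>i. s i \<omega>)
        * of_bool (ext_mode_path f T \<tau>0 \<sigma>0 (\<lambda>i. r i \<omega>) (\<lambda>i. s i \<omega>) (Suc k) = c') \<partial>\<Omega>)
    \<le> ennreal (ext_trans p q f T c c') * (\<integral>\<^sup>+\<omega>. \<phi> (\<lambda>i. r i \<omega>) (\<lambda>i. s i \<omega>) \<partial>\<Omega>)"
proof (cases "\<exists>h g. ext_mode_path f T \<tau>0 \<sigma>0 h g k = c \<and> ext_mode_path f T \<tau>0 \<sigma>0 h g (Suc k) = c'")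
  case False
  then have "\<phi> h g * of_bool (ext_mode_path f T \<tau>0 \<sigma>0 h g (Suc k) = c') = 0" for h g
    using supp[of h g] by auto
  then show ?thesis by (simp only: nn_integral_const mult_zero_left zero_le)
next
  case True
  have rv: "r i \<in> measurable \<Omega> (count_space UNIV)" "s i \<in> measurable \<Omega> (count_space UNIV)" for i
    using real by (simp_all add: realization_def markov_chain_def)
  obtain \<alpha> \<beta> \<gamma> \<delta> where c: "c = (\<alpha>, \<beta>, \<gamma>, \<delta>)" by (cases c)
  obtain \<alpha>' \<beta>' \<gamma>' \<delta>' where c': "c' = (\<alpha>', \<beta>', \<gamma>', \<delta>')" by (cases c')
  obtain h g where hg: "ext_mode_path f T \<tau>0 \<sigma>0 h g k = c" "ext_mode_path f T \<tau>0 \<sigma>0 h g (Suc k) = c'"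
    using True by blast
  \<comment> \<open>One sequence making the transition from \<open>c\<close> to \<open>c'\<close>
    fixes the value, since along it the indicator in \<open>ext_trans\<close> is one. If there is
    none, the left integrand vanishes.\<close>
  have trans: "ext_trans p q f T c c' = p \<alpha> \<alpha>' * q \<beta> \<beta>'"
    using ext_trans_path[OF T, of p q f \<tau>0 \<sigma>0 h g k, unfolded hg] hg
    by (simp only: c c' ext_mode_path_def prod.inject)
  \<comment> \<open>Forgetting the last two components of the next mode only enlarges the
    event.\<close>
  have "(\<integral>\<^sup>+\<omega>. \<phi> (\<lambda>i. r i \<omega>) (\<lambda>i. s i \<omega>)
        * of_bool (ext_mode_path f T \<tau>0 \<sigma>0 (\<lambda>i. r i \<omega>) (\<lambda>i. s i \<omega>) (Suc k) = c') \<partial>\<Omega>)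
    \<le> (\<integral>\<^sup>+\<omega>. \<phi> (\<lambda>i. r i \<omega>) (\<lambda>i. s i \<omega>)
        * indicator {\<omega> \<in> space \<Omega>. r (Suc k) \<omega> = \<alpha>' \<and> s (Suc k) \<omega> = \<beta>'} \<omega> \<partial>\<Omega>)"
    by (intro nn_integral_mono mult_left_mono) (auto simp: ext_mode_path_def c')
  also have "\<dots> = (\<integral>\<^sup>+\<omega>. \<phi> (\<lambda>i. r i \<omega>) (\<lambda>i. s i \<omega>) * ennreal (p (r k \<omega>) \<alpha>' * q (s k \<omega>) \<beta>') \<partial>\<Omega>)"
    by (rule realization_Markov[OF real st]) (erule \<phi>)
  \<comment> \<open>Where \<open>\<phi>\<close> does not vanish, the mode at time \<open>k\<close>
    is \<open>c\<close>, so the random transition probability is constant there.\<close>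
  also have "\<dots> = (\<integral>\<^sup>+\<omega>. \<phi> (\<lambda>i. r i \<omega>) (\<lambda>i. s i \<omega>) * ennreal (ext_trans p q f T c c') \<partial>\<Omega>)"
  proof (rule nn_integral_cong)
    fix \<omega>
    show "\<phi> (\<lambda>i. r i \<omega>) (\<lambda>i. s i \<omega>) * ennreal (p (r k \<omega>) \<alpha>' * q (s k \<omega>) \<beta>')
      = \<phi> (\<lambda>i. r i \<omega>) (\<lambda>i. s i \<omega>) * ennreal (ext_trans p q f T c c')"
    proof (cases "ext_mode_path f T \<tau>0 \<sigma>0 (\<lambda>i. r i \<omega>) (\<lambda>i. s i \<omega>) k = c")
      case True
      then show ?thesis unfolding trans by (simp add: c ext_mode_path_def)
    qed (simp add: supp)
  qed
  also have "\<dots> = (\<integral>\<^sup>+\<omega>. \<phi> (\<lambda>i. r i \<omega>) (\<lambda>i. s i \<omega>) \<partial>\<Omega>) * ennreal (ext_trans p q f T c c')"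
    by (rule nn_integral_multc) (rule path_function_measurable[OF rv], erule \<phi>)
  finally show ?thesis by (simp add: mult.commute)
qed

text \<open>Testing the second moment matrices with vectors keeps all integrals scalar and
  nonnegative. A time step transposes the closed-loop matrix onto the test vector, so the induction
  runs over all \<open>v\<close>. The power \<open>\<mu> ^ k\<close> belongs to the state at time
  \<open>Suc k\<close>.\<close>

lemma second_moment_bound:
  fixes r :: "nat \<Rightarrow> 'w \<Rightarrow> 'i::finite" and s :: "nat \<Rightarrow> 'w \<Rightarrow> 'j::finite"
    and Sys :: "('i, 'n::finite, 'm::finite, 'l::finite, 'q::finite) jump_system"
    and R :: "'i \<times> 'j \<times> 'i \<times> nat \<Rightarrow> real^'n^'n"
  assumes real: "realization \<Omega> r s p q r0 s0" and st: "stochastic p" "stochastic q" and T: "T > 0"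
    and psd: "\<And>c v. c \<in> ext_modes f T \<Longrightarrow> v \<bullet> (R c *v v) \<ge> 0"
    and "0 < \<mu>" "0 < b"
    and rate: "\<And>c v. c \<in> ext_modes f T \<Longrightarrow>
      (v v* closed_loop_matrix Sys K c) \<bullet> (ext_D p q f T R c *v (v v* closed_loop_matrix Sys K c))
        \<le> \<mu> * (v \<bullet> (R c *v v))"
    and init: "\<And>c v x. c \<in> ext_modes f T \<Longrightarrow>
      (v \<bullet> (closed_loop_matrix Sys K c *v x))\<^sup>2 \<le> b * (norm x)\<^sup>2 * (v \<bullet> (R c *v v))"
    and "c \<in> ext_modes f T"
  shows "(\<integral>\<^sup>+\<omega>. ennreal ((v \<bullet> undisturbed_state Sys K f T \<tau>0 \<sigma>0 x0 (\<lambda>i. r i \<omega>) (\<lambda>i. s i \<omega>) (Suc k))\<^sup>2)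
        * of_bool (ext_mode_path f T \<tau>0 \<sigma>0 (\<lambda>i. r i \<omega>) (\<lambda>i. s i \<omega>) k = c) \<partial>\<Omega>)
    \<le> ennreal (b * \<mu> ^ k * (norm x0)\<^sup>2 * (v \<bullet> (R c *v v)))"
  using \<open>c \<in> ext_modes f T\<close>
proof (induction k arbitrary: c v)
  case 0
  interpret prob_space \<Omega> using real by (simp add: realization_def)
  \<comment> \<open>At time 0 the state is \<open>x0\<close>, and on the event the first step uses
    the matrix of mode \<open>c\<close>; the probability of the event is bounded by one.\<close>
  have "(\<integral>\<^sup>+\<omega>. ennreal ((v \<bullet> undisturbed_state Sys K f T \<tau>0 \<sigma>0 x0 (\<lambda>i. r i \<omega>) (\<lambda>i. s i \<omega>) (Suc 0))\<^sup>2)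
        * of_bool (ext_mode_path f T \<tau>0 \<sigma>0 (\<lambda>i. r i \<omega>) (\<lambda>i. s i \<omega>) 0 = c) \<partial>\<Omega>)
    \<le> (\<integral>\<^sup>+\<omega>. ennreal (b * (norm x0)\<^sup>2 * (v \<bullet> (R c *v v))) \<partial>\<Omega>)"
    unfolding undisturbed_state_Suc
    using init[OF 0, of v x0] by (intro nn_integral_mono) (auto intro!: ennreal_leI)
  then show ?case by (simp add: emeasure_space_1)
next
  case (Suc k)
  let ?X = "ext_modes f T :: ('i \<times> 'j \<times> 'i \<times> nat) set"
  let ?p = "ext_mode_path f T \<tau>0 \<sigma>0"
  define \<phi> where "\<phi> c w h g = ennreal ((w \<bullet> undisturbed_state Sys K f T \<tau>0 \<sigma>0 x0 h g (Suc k))\<^sup>2)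
      * of_bool (?p h g k = c)" for c w h g
  define w where "w = v v* closed_loop_matrix Sys K c"
  have rv: "r i \<in> measurable \<Omega> (count_space UNIV)" "s i \<in> measurable \<Omega> (count_space UNIV)" for i
    using real by (simp_all add: realization_def markov_chain_def)
  have path_cong: "?p h g j = ?p h' g' j" if "\<forall>i\<le>j. h i = h' i \<and> g i = g' i" for h h' g g' j
    by (rule ext_mode_path_cong) (use that in auto)
  have \<phi>_cong: "\<phi> c' w h g = \<phi> c' w h' g'" if "\<forall>i\<le>k. h i = h' i \<and> g i = g' i" for c' h h' g g'
    unfolding \<phi>_def path_cong[OF that]
    by (subst undisturbed_state_cong[of _ h h' g g']) (use that in auto)
  \<comment> \<open>Exactly one \<open>c'\<close> is the mode at time \<open>k\<close>, so summing
    over the preceding mode changes nothing; \<open>w\<close> absorbs the matrix of the last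
    step.\<close>
  have split: "ennreal ((v \<bullet> undisturbed_state Sys K f T \<tau>0 \<sigma>0 x0 h g (Suc (Suc k)))\<^sup>2)
        * of_bool (?p h g (Suc k) = c)
      = (\<Sum>c'\<in>?X. \<phi> c' w h g * of_bool (?p h g (Suc k) = c))" for h g
  proof -
    have "(\<Sum>c'\<in>?X. \<phi> c' w h g * of_bool (?p h g (Suc k) = c))
        = (\<Sum>c'\<in>{?p h g k}. \<phi> c' w h g * of_bool (?p h g (Suc k) = c))"
      by (rule sum.mono_neutral_right[OF finite_ext_modes])
         (auto simp: \<phi>_def ext_mode_path_mem[OF T])
    then show ?thesis
      unfolding undisturbed_state_Suc[of _ _ _ _ _ _ _ _ _ "Suc k"]
      by (auto simp: \<phi>_def w_def dot_lmul_matrix)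
  qed
  have "(\<integral>\<^sup>+\<omega>. ennreal ((v \<bullet> undisturbed_state Sys K f T \<tau>0 \<sigma>0 x0 (\<lambda>i. r i \<omega>) (\<lambda>i. s i \<omega>) (Suc (Suc k)))\<^sup>2)
        * of_bool (?p (\<lambda>i. r i \<omega>) (\<lambda>i. s i \<omega>) (Suc k) = c) \<partial>\<Omega>)
    = (\<Sum>c'\<in>?X. \<integral>\<^sup>+\<omega>. \<phi> c' w (\<lambda>i. r i \<omega>) (\<lambda>i. s i \<omega>)
        * of_bool (?p (\<lambda>i. r i \<omega>) (\<lambda>i. s i \<omega>) (Suc k) = c) \<partial>\<Omega>)"
    unfolding split
  proof (rule nn_integral_sum)
    fix c'
    show "(\<lambda>\<omega>. \<phi> c' w (\<lambda>i. r i \<omega>) (\<lambda>i. s i \<omega>)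
        * of_bool (?p (\<lambda>i. r i \<omega>) (\<lambda>i. s i \<omega>) (Suc k) = c)) \<in> borel_measurable \<Omega>"
    proof (rule path_function_measurable[OF rv, of "Suc k"
          "\<lambda>h g. \<phi> c' w h g * of_bool (?p h g (Suc k) = c)"])
      fix h h' g g' assume eq: "\<forall>i\<le>Suc k. (h i :: 'i) = h' i \<and> (g i :: 'j) = g' i"
      have "\<phi> c' w h g = \<phi> c' w h' g'" by (rule \<phi>_cong) (use eq in auto)
      then show "\<phi> c' w h g * of_bool (?p h g (Suc k) = c)
          = \<phi> c' w h' g' * of_bool (?p h' g' (Suc k) = c)"
        unfolding path_cong[OF eq] by simp
    qed
  qed
  also have "\<dots> \<le> (\<Sum>c'\<in>?X. ennreal (ext_trans p q f T c' c)
      * ennreal (b * \<mu> ^ k * (norm x0)\<^sup>2 * (w \<bullet> (R c' *v w))))"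
  proof (rule sum_mono)
    fix c' assume c': "c' \<in> ?X"
    have "(\<integral>\<^sup>+\<omega>. \<phi> c' w (\<lambda>i. r i \<omega>) (\<lambda>i. s i \<omega>)
        * of_bool (?p (\<lambda>i. r i \<omega>) (\<lambda>i. s i \<omega>) (Suc k) = c) \<partial>\<Omega>)
      \<le> ennreal (ext_trans p q f T c' c) * (\<integral>\<^sup>+\<omega>. \<phi> c' w (\<lambda>i. r i \<omega>) (\<lambda>i. s i \<omega>) \<partial>\<Omega>)"
      by (rule ext_mode_step_le[OF real st T], erule \<phi>_cong) (simp add: \<phi>_def)
    also have "\<dots> \<le> ennreal (ext_trans p q f T c' c)
        * ennreal (b * \<mu> ^ k * (norm x0)\<^sup>2 * (w \<bullet> (R c' *v w)))"
      unfolding \<phi>_def using Suc.IH[OF c', of w] by (intro mult_left_mono) auto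
    finally show "(\<integral>\<^sup>+\<omega>. \<phi> c' w (\<lambda>i. r i \<omega>) (\<lambda>i. s i \<omega>)
        * of_bool (?p (\<lambda>i. r i \<omega>) (\<lambda>i. s i \<omega>) (Suc k) = c) \<partial>\<Omega>) \<le> \<dots>" .
  qed
  also have "\<dots> = (\<Sum>c'\<in>?X. ennreal (ext_trans p q f T c' c
      * (b * \<mu> ^ k * (norm x0)\<^sup>2 * (w \<bullet> (R c' *v w)))))"
    by (intro sum.cong refl ennreal_mult[symmetric] ext_trans_nonneg st mult_nonneg_nonneg psd)
       (use \<open>0 < \<mu>\<close> \<open>0 < b\<close> in auto)
  also have "\<dots> = ennreal (\<Sum>c'\<in>?X. ext_trans p q f T c' c
      * (b * \<mu> ^ k * (norm x0)\<^sup>2 * (w \<bullet> (R c' *v w))))"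
    by (intro sum_ennreal mult_nonneg_nonneg ext_trans_nonneg st psd)
       (use \<open>0 < \<mu>\<close> \<open>0 < b\<close> in auto)
  also have "(\<Sum>c'\<in>?X. ext_trans p q f T c' c * (b * \<mu> ^ k * (norm x0)\<^sup>2 * (w \<bullet> (R c' *v w))))
      = b * \<mu> ^ k * (norm x0)\<^sup>2 * (w \<bullet> (ext_D p q f T R c *v w))"
    by (simp add: ext_D_quadratic_form sum_distrib_left mult_ac)
  \<comment> \<open>The weighted sum over preceding modes is the form of \<open>ext_D\<close> at
    \<open>w\<close>, and the contraction inequality supplies the additional factor
    \<open>\<mu>\<close>.\<close>
  also have "ennreal \<dots> \<le> ennreal (b * \<mu> ^ k * (norm x0)\<^sup>2 * (\<mu> * (v \<bullet> (R c *v v))))"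
    unfolding w_def using \<open>0 < \<mu>\<close> \<open>0 < b\<close>
    by (intro ennreal_leI mult_left_mono rate Suc.prems) auto
  also have "b * \<mu> ^ k * (norm x0)\<^sup>2 * (\<mu> * (v \<bullet> (R c *v v)))
      = b * \<mu> ^ Suc k * (norm x0)\<^sup>2 * (v \<bullet> (R c *v v))" by simp
  finally show ?case .
qed

section \<open>From the matrix inequality to a uniform exponential bound\<close>

theorem theorem4p1:
  fixes Sys :: "('i::finite, 'n::finite, 'm::finite, 'l::finite, 'q::finite) jump_system"
    and p :: "'i \<Rightarrow> 'i \<Rightarrow> real" and q :: "'j::finite \<Rightarrow> 'j \<Rightarrow> real"
    and f :: "'j \<Rightarrow> nat" and T :: nat
    and R :: "'i \<times> 'j \<times> 'i \<times> nat \<Rightarrow> real^'n^'n"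
    and G :: "'i \<Rightarrow> nat \<Rightarrow> real^'n^'n"
    and F K :: "'i \<Rightarrow> nat \<Rightarrow> real^'n^'m"
  assumes "stochastic p" and "stochastic q"
    and "\<forall>\<beta>. f \<beta> \<in> {0, 1}" and "T > 0"
    and LMI: "\<forall>(\<alpha>, \<beta>, \<gamma>, \<delta>) \<in> ext_modes f T.
       pos_def (block_matrix
         (R (\<alpha>, \<beta>, \<gamma>, \<delta>))
         (mat_A Sys \<alpha> ** G \<gamma> \<delta> + mat_B Sys \<alpha> ** F \<gamma> \<delta>)
         (transpose (mat_A Sys \<alpha> ** G \<gamma> \<delta> + mat_B Sys \<alpha> ** F \<gamma> \<delta>))
         (G \<gamma> \<delta> + transpose (G \<gamma> \<delta>) - ext_D p q f T R (\<alpha>, \<beta>, \<gamma>, \<delta>)))"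
    and gains: "\<forall>(\<alpha>, \<beta>, \<gamma>, \<delta>) \<in> ext_modes f T. K \<gamma> \<delta> = F \<gamma> \<delta> ** matrix_inv (G \<gamma> \<delta>)"
  shows "mean_square_stable TYPE('w) Sys p q f T K"
proof -
  let ?X = "ext_modes f T :: ('i \<times> 'j \<times> 'i \<times> nat) set"
  let ?A = "closed_loop_matrix Sys K :: 'i \<times> 'j \<times> 'i \<times> nat \<Rightarrow> real^'n^'n"
  let ?D = "ext_D p q f T R"
  note st = \<open>stochastic p\<close> \<open>stochastic q\<close>
  have pos: "v \<bullet> (R c *v v) > 0" if c: "c \<in> ?X" and "v \<noteq> 0" for c v
  proof -
    obtain \<alpha> \<beta> \<gamma> \<delta> where c_eq: "c = (\<alpha>, \<beta>, \<gamma>, \<delta>)" by (cases c)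
    show ?thesis
      using pos_def_block_matrixD(4)[OF bspec[OF LMI c, unfolded c_eq prod.case], of v 0] \<open>v \<noteq> 0\<close>
      by (simp add: c_eq)
  qed
  then have psd: "v \<bullet> (R c *v v) \<ge> 0" if "c \<in> ?X" for c v
    using pos[OF that] by (cases "v = 0") (auto intro!: less_imp_le)
  have sym: "transpose (R c) = R c" if c: "c \<in> ?X" for c
  proof -
    obtain \<alpha> \<beta> \<gamma> \<delta> where c_eq: "c = (\<alpha>, \<beta>, \<gamma>, \<delta>)" by (cases c)
    show ?thesis
      using pos_def_block_matrixD(1)[OF bspec[OF LMI c, unfolded c_eq prod.case]] by (simp add: c_eq)
  qed
  have D_psd: "v \<bullet> (?D c *v v) \<ge> 0" for c v
    unfolding ext_D_quadratic_form by (intro sum_nonneg mult_nonneg_nonneg ext_trans_nonneg st psd)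
  have lyap: "(v v* ?A c) \<bullet> (?D c *v (v v* ?A c)) < v \<bullet> (R c *v v)" if c: "c \<in> ?X" and "v \<noteq> 0" for c v
  proof -
    obtain \<alpha> \<beta> \<gamma> \<delta> where c_eq: "c = (\<alpha>, \<beta>, \<gamma>, \<delta>)" by (cases c)
    note lmi = bspec[OF LMI c, unfolded c_eq prod.case]
    \<comment> \<open>Invertibility makes \<open>matrix_inv\<close> a genuine inverse, so that
      \<open>F = K G\<close> and the off-diagonal block factors as closed-loop matrix times
      \<open>G\<close>.\<close>
    have inv: "invertible (G \<gamma> \<delta>)" by (rule slack_lmi_invertible[OF lmi D_psd])
    have "K \<gamma> \<delta> = F \<gamma> \<delta> ** matrix_inv (G \<gamma> \<delta>)" using bspec[OF gains c] by (simp add: c_eq)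
    then have "K \<gamma> \<delta> ** G \<gamma> \<delta> = F \<gamma> \<delta>"
      by (simp add: matrix_mul_assoc[symmetric] matrix_inv_cancel[OF inv])
    then have "mat_A Sys \<alpha> ** G \<gamma> \<delta> + mat_B Sys \<alpha> ** F \<gamma> \<delta> = ?A c ** G \<gamma> \<delta>"
      by (simp add: c_eq matrix_add_rdistrib matrix_mul_assoc[symmetric])
    with lmi show ?thesis
      using slack_lmi_lyapunov[OF _ transpose_ext_D[OF sym] D_psd \<open>v \<noteq> 0\<close>] by (simp only: c_eq)
  qed
  obtain \<mu> b where \<mu>: "0 < \<mu>" "\<mu> < 1" and b: "0 < b"
    and rate: "\<And>c v. c \<in> ?X \<Longrightarrow> (v v* ?A c) \<bullet> (?D c *v (v v* ?A c)) \<le> \<mu> * (v \<bullet> (R c *v v))"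
    and init: "\<And>c v x. c \<in> ?X \<Longrightarrow> (v \<bullet> (?A c *v x))\<^sup>2 \<le> b * (norm x)\<^sup>2 * (v \<bullet> (R c *v v))"
    by (rule lyapunov_constants[of ?X R ?A ?D, OF finite_ext_modes pos lyap], assumption+)
       (rule that, assumption+)
  define e where "e i = (axis i 1 :: real^'n)" for i
  \<comment> \<open>The sum of the traces of all \<open>R c\<close>; it appears when the directional
    bounds are added over modes and basis vectors.\<close>
  define S where "S = (\<Sum>c\<in>?X. \<Sum>i\<in>UNIV. e i \<bullet> (R c *v e i))"
  have S: "S \<ge> 0" unfolding S_def by (intro sum_nonneg psd)
  \<comment> \<open>The summand 1 covers time 0. The division by \<open>\<mu>\<close> compensates
    the index shift, as the state at \<open>Suc j\<close> is bounded with
    \<open>\<mu> ^ j\<close>.\<close>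
  define C where "C = 1 + b * S / \<mu>"
  have C: "C \<ge> 1" using S b \<mu> by (simp add: C_def)
  \<comment> \<open>\<open>C\<close> and \<open>\<mu>\<close> are fixed before the probability space
    and the initial data, which gives the required uniformity.\<close>
  have bound: "(\<integral>\<^sup>+ \<omega>. ennreal ((norm (undisturbed_state Sys K f T \<tau>0 \<sigma>0 x0 (\<lambda>i. r i \<omega>) (\<lambda>i. s i \<omega>) k))\<^sup>2) \<partial>\<Omega>)
      \<le> ennreal (C * \<mu> ^ k * (norm x0)\<^sup>2)"
    if real: "realization \<Omega> r s p q r0 s0"
    for \<Omega> :: "'w measure" and r s x0 r0 s0 \<sigma>0 \<tau>0 k
  proof -
    interpret prob_space \<Omega> using real by (simp add: realization_def)
    have rv: "r i \<in> measurable \<Omega> (count_space UNIV)" "s i \<in> measurable \<Omega> (count_space UNIV)" for i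
      using real by (simp_all add: realization_def markov_chain_def)
    show ?thesis
    proof (cases k)
      case 0
      have "1 * (norm x0)\<^sup>2 \<le> C * (norm x0)\<^sup>2" using C by (intro mult_right_mono) auto
      then show ?thesis using 0 by (simp add: emeasure_space_1 ennreal_leI)
    next
      case (Suc j)
      define \<psi> where "\<psi> c i h g =
        ennreal ((e i \<bullet> undisturbed_state Sys K f T \<tau>0 \<sigma>0 x0 h g (Suc j))\<^sup>2)
          * of_bool (ext_mode_path f T \<tau>0 \<sigma>0 h g j = c)" for c i h g
      have \<psi>_meas: "(\<lambda>\<omega>. \<psi> c i (\<lambda>i. r i \<omega>) (\<lambda>i. s i \<omega>)) \<in> borel_measurable \<Omega>" for c i
      proof (rule path_function_measurable[OF rv])
        fix h h' g g' assume eq: "\<forall>i\<le>j. (h i :: 'i) = h' i \<and> (g i :: 'j) = g' i"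
        have "ext_mode_path f T \<tau>0 \<sigma>0 h g j = ext_mode_path f T \<tau>0 \<sigma>0 h' g' j"
          by (rule ext_mode_path_cong) (use eq in auto)
        moreover have "undisturbed_state Sys K f T \<tau>0 \<sigma>0 x0 h g (Suc j)
            = undisturbed_state Sys K f T \<tau>0 \<sigma>0 x0 h' g' (Suc j)"
          by (rule undisturbed_state_cong) (use eq in auto)
        ultimately show "\<psi> c i h g = \<psi> c i h' g'" unfolding \<psi>_def by simp
      qed
      \<comment> \<open>The squared norm is split by coordinates and by the mode at time
        \<open>j\<close>, the form in which the directional bound applies.\<close>
      have split: "ennreal ((norm (undisturbed_state Sys K f T \<tau>0 \<sigma>0 x0 h g (Suc j)))\<^sup>2)
          = (\<Sum>c\<in>?X. \<Sum>i\<in>UNIV. \<psi> c i h g)" for h g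
      proof -
        have "(\<Sum>c\<in>?X. \<Sum>i\<in>UNIV. \<psi> c i h g)
            = (\<Sum>c\<in>{ext_mode_path f T \<tau>0 \<sigma>0 h g j}. \<Sum>i\<in>UNIV. \<psi> c i h g)"
          by (rule sum.mono_neutral_right[OF finite_ext_modes])
             (auto simp: \<psi>_def ext_mode_path_mem[OF \<open>T > 0\<close>])
        also have "\<dots> = ennreal (\<Sum>i\<in>UNIV. (e i \<bullet> undisturbed_state Sys K f T \<tau>0 \<sigma>0 x0 h g (Suc j))\<^sup>2)"
          by (simp add: \<psi>_def del: closed_loop_state.simps)
        also have "(\<Sum>i\<in>UNIV. (e i \<bullet> y)\<^sup>2) = (norm y)\<^sup>2" for y :: "real^'n"
          unfolding power2_norm_eq_inner inner_vec_def[of y]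
          by (simp add: e_def inner_axis' power2_eq_square)
        finally show ?thesis ..
      qed
      have "(\<integral>\<^sup>+ \<omega>. ennreal ((norm (undisturbed_state Sys K f T \<tau>0 \<sigma>0 x0 (\<lambda>i. r i \<omega>) (\<lambda>i. s i \<omega>) (Suc j)))\<^sup>2) \<partial>\<Omega>)
          = (\<Sum>c\<in>?X. \<Sum>i\<in>UNIV. \<integral>\<^sup>+ \<omega>. \<psi> c i (\<lambda>i. r i \<omega>) (\<lambda>i. s i \<omega>) \<partial>\<Omega>)"
        unfolding split by (simp add: nn_integral_sum borel_measurable_sum \<psi>_meas)
      also have "\<dots> \<le> (\<Sum>c\<in>?X. \<Sum>i\<in>UNIV. ennreal (b * \<mu> ^ j * (norm x0)\<^sup>2 * (e i \<bullet> (R c *v e i))))"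
        unfolding \<psi>_def
        by (intro sum_mono second_moment_bound[OF real st \<open>T > 0\<close> psd \<mu>(1) b rate init])
      also have "\<dots> = ennreal (\<Sum>c\<in>?X. \<Sum>i\<in>UNIV. b * \<mu> ^ j * (norm x0)\<^sup>2 * (e i \<bullet> (R c *v e i)))"
      proof -
        have nn: "0 \<le> b * \<mu> ^ j * (norm x0)\<^sup>2 * (e i \<bullet> (R c *v e i))" if "c \<in> ?X" for c i
          using \<mu> b psd[OF that] by (intro mult_nonneg_nonneg) auto
        then show ?thesis
          by (subst sum_ennreal[symmetric])
             (auto intro!: sum.cong sum_nonneg sum_ennreal)
      qed
      also have "(\<Sum>c\<in>?X. \<Sum>i\<in>UNIV. b * \<mu> ^ j * (norm x0)\<^sup>2 * (e i \<bullet> (R c *v e i)))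
          = b * S * \<mu> ^ j * (norm x0)\<^sup>2"
        by (simp add: S_def sum_distrib_left mult_ac)
      also have "ennreal \<dots> \<le> ennreal (C * \<mu> ^ Suc j * (norm x0)\<^sup>2)"
      proof (intro ennreal_leI mult_right_mono)
        have "b * S \<le> C * \<mu>" using \<mu> by (simp add: C_def field_simps)
        then have "b * S * \<mu> ^ j \<le> C * \<mu> * \<mu> ^ j" using \<mu> by (intro mult_right_mono) auto
        then show "b * S * \<mu> ^ j \<le> C * \<mu> ^ Suc j" by (simp add: mult_ac)
      qed auto
      finally show ?thesis unfolding Suc .
    qed
  qed
  have "0 < C" using C by simp
  with \<mu> bound show ?thesis
    unfolding mean_square_stable_def by (intro exI[of _ C] exI[of _ \<mu>] conjI allI impI) auto
qed

end
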